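(* Let $S$ be an ai-semiring such that $\mathsf{V}(S_7)\subseteq\mathsf{V}(S)\subseteq \mathsf{V}(B_2^1)$. Then the interval $[\mathsf{V}(S),\mathsf{V}(S^0)]$ has cardinality $2^{\aleph_0}$.
   Context: An ai-semiring is an algebra $(S,+,\cdot)$ with two binary operations (no constants in the signature) such that $(S,+)$ is a commutative idempotent semigroup, $(S,\cdot)$ is a semigroup, and $x(y+z)\approx xy+xz$, $(x+y)z\approx xz+yz$ hold. $\mathsf{V}(S)$ is the variety of ai-semirings generated by $S$. For ai-semiring varieties $\mathcal{A}\subseteq\mathcal{B}$, $[\mathcal{A},\mathcal{B}]$ is the class of all varieties $\mathcal{C}$ with $\mathcal{A}\subseteq\mathcal{C}\subseteq\mathcal{B}$. For an ai-semiring $S$, $S^0=S\cup\{0\}$ is the ai-semiring obtained by adjoining a new element $0$ with $s+0=0+s=s$ and $s0=0s=0$ for all $s\in S\cup\{0\}$, the operations on $S$ being preserved. (If $S$ already has an element called $0$, the adjoined one is a different new element.) $S_7$ is the 3-element ai-semiring $\{0,a,1\}$ with $x+x=x$, $x+y=0$ for $x\neq y$, and commutative multiplication in which $1$ is an identity element, $0$ is a zero element, and $a\cdot a=0$. $B_2^1$ is the 6-element ai-semiring $\{0,1,a,b,ab,ba\}$ of $2\times 2$ matrices under matrix multiplication, where $0$ is the zero matrix, $1$ the identity matrix, $a=\begin{bmatrix}0&1\\0&0\end{bmatrix}$, $b=\begin{bmatrix}0&0\\1&0\end{bmatrix}$, $ab=\begin{bmatrix}1&0\\0&0\end{bmatrix}$,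 $ba=\begin{bmatrix}0&0\\0&1\end{bmatrix}$; its addition is the join operation of the partial order whose covering relations are $1<ab$, $1<ba$, $ab<0$, $ba<0$, $a<0$, $b<0$. *)

theory Defs
  imports "HOL-Analysis.Analysis" "HOL-Algebra.Congruence" "HOL-Library.Equipollence"
begin

section \<open>Ai-semirings\<close>

text \<open>The operations of an algebra are only meaningful on its carrier.\<close>

record 'a sr_alg = "'a partial_object" +
  sr_add :: "'a \<Rightarrow> 'a \<Rightarrow> 'a"
  sr_mul :: "'a \<Rightarrow> 'a \<Rightarrow> 'a"

locale ai_semiring =
  fixes S :: "'a sr_alg"
  assumes nonempty: "carrier S \<noteq> {}"
    and add_closed: "\<lbrakk>x \<in> carrier S; y \<in> carrier S\<rbrakk> \<Longrightarrow> sr_add S x y \<in> carrier S"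
    and mul_closed: "\<lbrakk>x \<in> carrier S; y \<in> carrier S\<rbrakk> \<Longrightarrow> sr_mul S x y \<in> carrier S"
    and add_assoc: "\<lbrakk>x \<in> carrier S; y \<in> carrier S; z \<in> carrier S\<rbrakk>
      \<Longrightarrow> sr_add S (sr_add S x y) z = sr_add S x (sr_add S y z)"
    and add_comm: "\<lbrakk>x \<in> carrier S; y \<in> carrier S\<rbrakk> \<Longrightarrow> sr_add S x y = sr_add S y x"
    and add_idem: "x \<in> carrier S \<Longrightarrow> sr_add S x x = x"
    and mul_assoc: "\<lbrakk>x \<in> carrier S; y \<in> carrier S; z \<in> carrier S\<rbrakk>
      \<Longrightarrow> sr_mul S (sr_mul S x y) z = sr_mul S x (sr_mul S y z)"
    and distrib_left: "\<lbrakk>x \<in> carrier S; y \<in> carrier S; z \<in> carrier S\<rbrakk>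
      \<Longrightarrow> sr_mul S x (sr_add S y z) = sr_add S (sr_mul S x y) (sr_mul S x z)"
    and distrib_right: "\<lbrakk>x \<in> carrier S; y \<in> carrier S; z \<in> carrier S\<rbrakk>
      \<Longrightarrow> sr_mul S (sr_add S x y) z = sr_add S (sr_mul S x z) (sr_mul S y z)"


section \<open>Identities and varieties\<close>

datatype sr_term = Var nat | Plus sr_term sr_term | Times sr_term sr_term

primrec sr_eval :: "'a sr_alg \<Rightarrow> (nat \<Rightarrow> 'a) \<Rightarrow> sr_term \<Rightarrow> 'a" where
  "sr_eval S v (Var i) = v i"
| "sr_eval S v (Plus s t) = sr_add S (sr_eval S v s) (sr_eval S v t)"
| "sr_eval S v (Times s t) = sr_mul S (sr_eval S v s) (sr_eval S v t)"

text \<open>A pair of terms \<open>(s, t)\<close> stands for the identity \<open>s \<approx> t\<close>.\<close>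

definition satisfies :: "'a sr_alg \<Rightarrow> (sr_term \<times> sr_term) set \<Rightarrow> bool" where
  "satisfies S \<Sigma> \<longleftrightarrow>
     (\<forall>(s, t)\<in>\<Sigma>. \<forall>v. range v \<subseteq> carrier S \<longrightarrow> sr_eval S v s = sr_eval S v t)"

text \<open>
  Varieties are equational classes. Classes of algebras are formed inside a universe: the algebras whose carrier is a subset of a
  type \<open>'u\<close>, which is meant to be infinite (of any cardinality). A variety is determined by its
  at most countable members, as the signature is finite and an identity has finitely many variables.
  Hence over an infinite \<open>'u\<close> distinct varieties have distinct traces on the universe, and inclusion
  of traces is the same as inclusion of varieties.
\<close>

definition models :: "(sr_term \<times> sr_term) set \<Rightarrow> 'u sr_alg set" where
  "models \<Sigma> = {A. ai_semiring A \<and> satisfies A \<Sigma>}"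

definition variety :: "'u sr_alg set \<Rightarrow> bool" where
  "variety \<C> \<longleftrightarrow> (\<exists>\<Sigma>. \<C> = models \<Sigma>)"

text \<open>
  The variety \<open>V(S)\<close>, as the intersection of all varieties containing \<open>S\<close>. The algebra \<open>S\<close> may live
  on another type than the universe (and so be too large to belong to it), so that
  ``the variety defined by \<open>\<Sigma>\<close> contains \<open>S\<close>'' is expressed as ``\<open>S\<close> satisfies \<open>\<Sigma>\<close>''.
\<close>

definition gen_variety :: "'a sr_alg \<Rightarrow> 'u sr_alg set" where
  "gen_variety S = \<Inter> {models \<Sigma> | \<Sigma>. satisfies S \<Sigma>}"

lemma gen_variety_eq_models:
  "gen_variety S = models {(s, t). satisfies S {(s, t)}}"
  unfolding gen_variety_def models_def
proof (intro equalityI subsetI, goal_cases)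
  case (1 A)
  have "satisfies S {(s, t). satisfies S {(s, t)}}"
    by (auto simp: satisfies_def)
  with 1 show ?case by blast
next
  case (2 A)
  then show ?case by (fastforce simp: satisfies_def)
qed

lemma variety_gen_variety: "variety (gen_variety S)"
  unfolding variety_def gen_variety_eq_models by blast

lemma gen_variety_contains: "ai_semiring S \<Longrightarrow> S \<in> gen_variety S"
  by (auto simp: gen_variety_def models_def)

lemma gen_variety_least: "\<lbrakk>variety \<C>; S \<in> \<C>\<rbrakk> \<Longrightarrow> gen_variety S \<subseteq> \<C>"
  by (auto simp: gen_variety_def variety_def models_def)

definition variety_interval :: "'u sr_alg set \<Rightarrow> 'u sr_alg set \<Rightarrow> 'u sr_alg set set" where
  "variety_interval \<A> \<B> = {\<C>. variety \<C> \<and> \<A> \<subseteq> \<C> \<and> \<C> \<subseteq> \<B>}"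


section \<open>Adjoining a new element \<open>0\<close>\<close>

text \<open>\<open>None\<close> is the adjoined element.\<close>

fun add0 :: "('a \<Rightarrow> 'a \<Rightarrow> 'a) \<Rightarrow> 'a option \<Rightarrow> 'a option \<Rightarrow> 'a option" where
  "add0 f None y = y"
| "add0 f x None = x"
| "add0 f (Some x) (Some y) = Some (f x y)"

fun mul0 :: "('a \<Rightarrow> 'a \<Rightarrow> 'a) \<Rightarrow> 'a option \<Rightarrow> 'a option \<Rightarrow> 'a option" where
  "mul0 f None y = None"
| "mul0 f x None = None"
| "mul0 f (Some x) (Some y) = Some (f x y)"

definition adjoin_zero :: "'a sr_alg \<Rightarrow> 'a option sr_alg" where
  "adjoin_zero S =
     \<lparr>carrier = insert None (Some ` carrier S), sr_add = add0 (sr_add S), sr_mul = mul0 (sr_mul S)\<rparr>"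

lemma ai_semiring_adjoin_zero:
  assumes "ai_semiring S"
  shows "ai_semiring (adjoin_zero S)"
proof -
  interpret ai_semiring S by fact
  show ?thesis
    by unfold_locales
      (auto simp: adjoin_zero_def add_closed mul_closed add_assoc add_idem mul_assoc
        distrib_left distrib_right intro: add_comm)
qed


section \<open>The ai-semiring \<open>S\<^sub>7\<close>\<close>

datatype s7 = S7_zero | S7_a | S7_one

definition S7 :: "s7 sr_alg" where
  "S7 = \<lparr>carrier = UNIV,
         sr_add = (\<lambda>x y. if x = y then x else S7_zero),
         sr_mul = (\<lambda>x y. if x = S7_one then y else if y = S7_one then x else S7_zero)\<rparr>"

lemma ai_semiring_S7: "ai_semiring S7"
proof unfold_locales
  fix x y z
  show "sr_mul S7 x (sr_add S7 y z) = sr_add S7 (sr_mul S7 x y) (sr_mul S7 x z)"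
    by (cases x; cases y; cases z) (simp_all add: S7_def)
  show "sr_mul S7 (sr_add S7 x y) z = sr_add S7 (sr_mul S7 x z) (sr_mul S7 y z)"
    by (cases x; cases y; cases z) (simp_all add: S7_def)
qed (auto simp: S7_def)


section \<open>The ai-semiring \<open>B\<^sub>2\<^sup>1\<close>\<close>

definition B21_a :: "int^2^2" where
  "B21_a = vector [vector [0, 1], vector [0, 0]]"

definition B21_b :: "int^2^2" where
  "B21_b = vector [vector [0, 0], vector [1, 0]]"

definition B21_carrier :: "(int^2^2) set" where
  "B21_carrier = {0, mat 1, B21_a, B21_b, B21_a ** B21_b, B21_b ** B21_a}"

definition B21_covers :: "(int^2^2) rel" where
  "B21_covers =
     {(mat 1, B21_a ** B21_b), (mat 1, B21_b ** B21_a),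
      (B21_a ** B21_b, 0), (B21_b ** B21_a, 0), (B21_a, 0), (B21_b, 0)}"

definition B21_le :: "int^2^2 \<Rightarrow> int^2^2 \<Rightarrow> bool" where
  "B21_le x y \<longleftrightarrow> (x, y) \<in> B21_covers\<^sup>*"

definition B21_is_join :: "int^2^2 \<Rightarrow> int^2^2 \<Rightarrow> int^2^2 \<Rightarrow> bool" where
  "B21_is_join x y z \<longleftrightarrow> z \<in> B21_carrier \<and> B21_le x z \<and> B21_le y z \<and>
     (\<forall>w\<in>B21_carrier. B21_le x w \<and> B21_le y w \<longrightarrow> B21_le z w)"

definition B21 :: "(int^2^2) sr_alg" where
  "B21 = \<lparr>carrier = B21_carrier,
          sr_add = (\<lambda>x y. THE z. B21_is_join x y z),
          sr_mul = (\<lambda>x y. x ** y)\<rparr>"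

end

theory Submission
  imports Defs "HOL-Library.Multiset" "HOL-Library.Countable" "HOL-Library.Nat_Bijection"
begin

text \<open>
  There are only continuum many sets of identities, so the interval has at most that many members.
  For the lower bound, let \<open>p \<ge> 2\<close> and arrange \<open>p * p\<close> variables in a square grid. The grid identity
  says that the sum of all rows and of all columns but the last absorbs the last column, each row and
  column being read as a product. It is an identity of \<open>S\<^sub>7\<close> by double counting: where the sum has the
  value \<open>a\<close>, every row and every column but the last contains exactly one variable with the value \<open>a\<close>,
  so there are \<open>p\<close> such variables, of which \<open>p - 1\<close> lie outside the last column. If each row also
  occurs in all its cyclic rotations, the same argument works in \<open>B\<^sub>2\<^sup>1\<close>
  (\<open>B21_satisfies_grid_identity\<close>), and hence the identity holds in \<open>S\<close>.

  In \<open>S\<^sup>0\<close> the identity breaks down, because setting the variables outside the last column to \<open>0\<close>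
  erases the whole sum but not the last column. What is more, the grid identities are independent over
  the identities of \<open>S\<^sup>0\<close>. A witness of this is the grid algebra for \<open>p\<close>. It consists of sets of
  commutative monomials in the cells of a grid, and two such sets are identified if the same contexts
  multiply them into the rows and the columns but the last. It satisfies all identities of
  \<open>S\<^sup>0\<close> (\<open>grid_algebra_satisfies\<close>), because these target monomials are cut out by
  tests with values in \<open>S\<^sub>7\<close> and tests that only ask which variables are \<open>0\<close>. It fails the \<open>p\<close>-th grid
  identity (\<open>grid_algebra_fails\<close>), as the last column is no target. It satisfies the \<open>q\<close>-th one
  for \<open>q \<noteq> p\<close> (\<open>grid_algebra_satisfies_other\<close>): if \<open>q > p\<close> then products of \<open>q\<close> monomials are
  too long to be targets, and if \<open>q < p\<close> then the \<open>q\<close> rows of the small grid cannot be sent to all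
  \<open>p\<close> rows of the large one, which forces the image of the last column to be a target
  (\<open>smaller_grid_closed\<close>).

  So distinct sets of grid identities, added to those of \<open>S\<^sup>0\<close>, define distinct varieties, and all of
  these contain \<open>S\<close>. To see the difference inside the universe, a grid algebra is replaced by a copy of
  a countable subalgebra of it (\<open>failure_in_infinite_universe\<close>); the same device turns the
  inclusions of traces assumed for \<open>S\<close> into inclusions of equational theories.
\<close>

section \<open>Countable algebras determine varieties\<close>

instance sr_term :: countable
  by countable_datatype

lemma (in ai_semiring) sr_eval_closed:
  "range v \<subseteq> carrier S \<Longrightarrow> sr_eval S v t \<in> carrier S"
  by (induction t) (auto simp: add_closed mul_closed)

lemma satisfies_singleD:
  "\<lbrakk>satisfies S {(s, t)}; range v \<subseteq> carrier S\<rbrakk> \<Longrightarrow> sr_eval S v s = sr_eval S v t"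
  by (auto simp: satisfies_def)

lemma satisfies_iff_single: "satisfies S \<Sigma> \<longleftrightarrow> (\<forall>\<sigma>\<in>\<Sigma>. satisfies S {\<sigma>})"
  by (auto simp: satisfies_def)

text \<open>
  The values of all terms under a single falsifying assignment form a countable subalgebra, since there
  are countably many terms. It still falsifies the identity and inherits all identities, and an
  infinite type has room for a copy of it.
\<close>

lemma failure_in_infinite_universe:
  fixes B :: "'b sr_alg"
  assumes "infinite (UNIV :: 'u set)" and "ai_semiring B" and "\<not> satisfies B {(s, t)}"
  obtains A :: "'u sr_alg" where "ai_semiring A" "\<not> satisfies A {(s, t)}"
    "\<And>\<Sigma>. satisfies B \<Sigma> \<Longrightarrow> satisfies A \<Sigma>"
proof -
  interpret B: ai_semiring B by fact
  obtain v where v: "range v \<subseteq> carrier B" "sr_eval B v s \<noteq> sr_eval B v t"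
    using assms(3) by (auto simp: satisfies_def)
  define C where "C = range (sr_eval B v)"
  have C: "C \<subseteq> carrier B"
    using B.sr_eval_closed[OF v(1)] by (auto simp: C_def)
  have addC: "sr_add B x y \<in> C" and mulC: "sr_mul B x y \<in> C" if xy: "x \<in> C" "y \<in> C" for x y
  proof -
    obtain a b where ab: "x = sr_eval B v a" "y = sr_eval B v b"
      using xy by (auto simp: C_def)
    have "sr_add B x y = sr_eval B v (Plus a b)" "sr_mul B x y = sr_eval B v (Times a b)"
      by (simp_all add: ab)
    then show "sr_add B x y \<in> C" "sr_mul B x y \<in> C"
      unfolding C_def by blast+
  qed
  have "countable C" "C \<noteq> {}"
    by (simp_all add: C_def)
  obtain f :: "nat \<Rightarrow> 'u" where f: "inj f"
    using infinite_countable_subset[OF assms(1)] by blast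
  define h where "h = f \<circ> to_nat_on C"
  have h: "inj_on h C"
    unfolding h_def by (intro comp_inj_on inj_on_to_nat_on \<open>countable C\<close> inj_on_subset[OF f]) auto
  define g where "g = inv_into C h"
  have gh [simp]: "g (h x) = x" if "x \<in> C" for x
    using h that by (simp add: g_def)
  define A where "A = \<lparr>carrier = h ` C, sr_add = (\<lambda>x y. h (sr_add B (g x) (g y))),
    sr_mul = (\<lambda>x y. h (sr_mul B (g x) (g y)))\<rparr>"
  have A_simps: "carrier A = h ` C" "sr_add A x y = h (sr_add B (g x) (g y))"
    "sr_mul A x y = h (sr_mul B (g x) (g y))" for x y
    by (simp_all add: A_def)
  have Cc: "x \<in> carrier B" if "x \<in> C" for x
    using C that by blast
  have "ai_semiring A"
    by unfold_locales
      (auto simp: A_simps \<open>C \<noteq> {}\<close> addC mulC Cc B.add_assoc B.mul_assoc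
        B.add_idem B.distrib_left B.distrib_right intro: B.add_comm[THEN arg_cong])
  have eval: "sr_eval A w r \<in> h ` C \<and> g (sr_eval A w r) = sr_eval B (g \<circ> w) r"
    if "range w \<subseteq> h ` C" for w :: "nat \<Rightarrow> 'u" and r
  proof (induction r)
    case (Var i)
    then show ?case using that by auto
  next
    case (Plus r1 r2)
    then show ?case by (auto simp: A_simps addC)
  next
    case (Times r1 r2)
    then show ?case by (auto simp: A_simps mulC)
  qed
  have "satisfies A \<Sigma>" if "satisfies B \<Sigma>" for \<Sigma>
    unfolding satisfies_def
  proof clarify
    fix a b and w :: "nat \<Rightarrow> 'u"
    assume ab: "(a, b) \<in> \<Sigma>" and w: "range w \<subseteq> carrier A"
    have w': "range w \<subseteq> h ` C" using w by (simp add: A_simps)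
    have "g (w i) \<in> carrier B" for i
    proof -
      have "w i \<in> h ` C" using w' by blast
      then show ?thesis using Cc by auto
    qed
    then have "range (g \<circ> w) \<subseteq> carrier B"
      by (simp add: image_subset_iff)
    then have "sr_eval B (g \<circ> w) a = sr_eval B (g \<circ> w) b"
      using \<open>satisfies B \<Sigma>\<close> ab by (auto simp: satisfies_def)
    then have "g (sr_eval A w a) = g (sr_eval A w b)"
      using eval[OF w'] by simp
    moreover have "h (g (sr_eval A w r)) = sr_eval A w r" for r
      using eval[OF w', of r] f_inv_into_f[of "sr_eval A w r" h C] by (simp only: g_def)
    ultimately show "sr_eval A w a = sr_eval A w b"
      by metis
  qed
  moreover have "\<not> satisfies A {(s, t)}"
  proof
    assume sat: "satisfies A {(s, t)}"
    have vC: "v i \<in> C" for i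
      unfolding C_def by (rule range_eqI[of _ _ "Var i"]) simp
    then have r: "range (h \<circ> v) \<subseteq> h ` C" by auto
    have "sr_eval A (h \<circ> v) s = sr_eval A (h \<circ> v) t"
      using satisfies_singleD[OF sat] r by (simp add: A_simps)
    moreover have "g \<circ> (h \<circ> v) = v"
      using vC by auto
    ultimately show False
      using eval[OF r, of s] eval[OF r, of t] v(2) by metis
  qed
  ultimately show thesis
    using \<open>ai_semiring A\<close> that by blast
qed

text \<open>
  Traces on an infinite universe determine equational theories, also for algebras that are too large to
  have a copy in the universe.
\<close>

lemma satisfies_if_gen_variety_subset:
  fixes S :: "'a sr_alg" and T :: "'b sr_alg"
  assumes "infinite (UNIV :: 'u set)" and "ai_semiring S"
    and "(gen_variety S :: 'u sr_alg set) \<subseteq> gen_variety T" and "satisfies T {(s, t)}"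
  shows "satisfies S {(s, t)}"
proof (rule ccontr)
  assume "\<not> satisfies S {(s, t)}"
  then obtain A :: "'u sr_alg" where A: "ai_semiring A" "\<not> satisfies A {(s, t)}"
    "\<And>\<Sigma>. satisfies S \<Sigma> \<Longrightarrow> satisfies A \<Sigma>"
    using failure_in_infinite_universe[OF assms(1,2)] by blast
  have "A \<in> gen_variety S"
    using A(1,3) by (auto simp: gen_variety_def models_def)
  then have "A \<in> gen_variety T"
    using assms(3) by blast
  then show False
    using A(2) assms(4) by (auto simp: gen_variety_def models_def)
qed

lemma varieties_lepoll: "{\<C> :: 'u sr_alg set. variety \<C>} \<lesssim> (UNIV :: nat set set)"
proof -
  have "{\<C> :: 'u sr_alg set. variety \<C>} = range models"
    by (auto simp: variety_def)
  then have "{\<C> :: 'u sr_alg set. variety \<C>} \<lesssim> (UNIV :: (sr_term \<times> sr_term) set set)"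
    by (simp add: image_lepoll)
  also have "(UNIV :: (sr_term \<times> sr_term) set set) \<lesssim> (UNIV :: nat set set)"
    unfolding lepoll_def
    by (intro exI[of _ "image (to_nat :: sr_term \<times> sr_term \<Rightarrow> nat)"])
      (auto simp: inj_on_def inj_image_eq_iff)
  finally show ?thesis .
qed

lemma satisfies_adjoin_zeroD:
  assumes "satisfies (adjoin_zero S) {(s, t)}"
  shows "satisfies S {(s, t)}"
proof -
  have ev: "sr_eval (adjoin_zero S) (Some \<circ> v) r = Some (sr_eval S v r)" for v r
    by (induction r) (simp_all add: adjoin_zero_def)
  have "sr_eval S v s = sr_eval S v t" if "range v \<subseteq> carrier S" for v
  proof -
    have "range (Some \<circ> v) \<subseteq> carrier (adjoin_zero S)"
      using that by (auto simp: adjoin_zero_def)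
    then have "sr_eval (adjoin_zero S) (Some \<circ> v) s = sr_eval (adjoin_zero S) (Some \<circ> v) t"
      by (rule satisfies_singleD[OF assms])
    then show ?thesis by (simp only: ev option.inject)
  qed
  then show ?thesis
    by (auto simp: satisfies_def)
qed

section \<open>Terms as finite sets of words\<close>

text \<open>
  By distributivity a term is a sum of words. The grid identities are given by their sets of words, and
  values of terms will be computed from those sets.
\<close>

primrec lang :: "sr_term \<Rightarrow> nat list set" where
  "lang (Var i) = {[i]}"
| "lang (Plus s t) = lang s \<union> lang t"
| "lang (Times s t) = {xs @ ys | xs ys. xs \<in> lang s \<and> ys \<in> lang t}"

fun word_term :: "nat list \<Rightarrow> sr_term" where
  "word_term [] = Var 0"
| "word_term [x] = Var x"
| "word_term (x # y # ys) = Times (Var x) (word_term (y # ys))"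

fun sum_term :: "nat list list \<Rightarrow> sr_term" where
  "sum_term [] = Var 0"
| "sum_term [w] = word_term w"
| "sum_term (w # w' # ws) = Plus (word_term w) (sum_term (w' # ws))"

lemma lang_word_term: "w \<noteq> [] \<Longrightarrow> lang (word_term w) = {w}"
  by (induction w rule: word_term.induct) auto

lemma lang_sum_term: "\<lbrakk>ws \<noteq> []; [] \<notin> set ws\<rbrakk> \<Longrightarrow> lang (sum_term ws) = set ws"
proof (induction ws rule: sum_term.induct)
  case (2 w)
  then have "w \<noteq> []" by auto
  then show ?case by (simp add: lang_word_term)
next
  case (3 w w' ws)
  then have "w \<noteq> []" by auto
  then show ?case using 3 by (simp add: lang_word_term insert_commute)
qed simp

definition grid_row :: "nat \<Rightarrow> nat \<Rightarrow> nat list" where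
  "grid_row p i = map (\<lambda>j. prod_encode (i, j)) [0..<p]"

definition grid_column :: "nat \<Rightarrow> nat \<Rightarrow> nat list" where
  "grid_column p j = map (\<lambda>i. prod_encode (i, j)) [0..<p]"

text \<open>
  The rotations of a row all have the same commutative image. In \<open>B\<^sub>2\<^sup>1\<close> they make every variable
  of the grid occur both as the first and as the last letter of some word, which restricts its values
  to those for which the double counting of \<open>S\<^sub>7\<close> goes through.
\<close>

definition grid_words :: "nat \<Rightarrow> nat list list" where
  "grid_words p = [rotate r (grid_row p i). i \<leftarrow> [0..<p], r \<leftarrow> [0..<p]]
     @ map (grid_column p) [0..<p - 1]"

definition grid_identity :: "nat \<Rightarrow> sr_term \<times> sr_term" where
  "grid_identity p = (sum_term (grid_words p),
     Plus (sum_term (grid_words p)) (word_term (grid_column p (p - 1))))"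

lemma set_grid_words:
  "set (grid_words p) = {rotate r (grid_row p i) | i r. i < p \<and> r < p} \<union> grid_column p ` {..<p - 1}"
  by (fastforce simp: grid_words_def lessThan_atLeast0)

lemma lang_grid_identity:
  assumes "2 \<le> p"
  shows "lang (fst (grid_identity p)) = set (grid_words p)"
    and "lang (snd (grid_identity p)) = insert (grid_column p (p - 1)) (set (grid_words p))"
proof -
  have "grid_words p \<noteq> []"
    using assms by (simp add: grid_words_def)
  moreover have "length w = p" if "w \<in> set (grid_words p)" for w
    using that by (auto simp: set_grid_words grid_row_def grid_column_def)
  then have "[] \<notin> set (grid_words p)"
    using assms by (metis list.size(3) not_numeral_le_zero)
  moreover have "grid_column p (p - 1) \<noteq> []"
    using assms by (simp add: grid_column_def)
  ultimately show "lang (fst (grid_identity p)) = set (grid_words p)"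
    and "lang (snd (grid_identity p)) = insert (grid_column p (p - 1)) (set (grid_words p))"
    by (simp_all add: grid_identity_def lang_sum_term lang_word_term)
qed

section \<open>The grid identities hold in the Brandt monoid\<close>

lemma B21_entries:
  "(B21_a :: int^2^2) $ 1 $ 1 = 0" "B21_a $ 1 $ 2 = 1" "B21_a $ 2 $ 1 = 0" "B21_a $ 2 $ 2 = 0"
  "B21_b $ 1 $ 1 = 0" "B21_b $ 1 $ 2 = 0" "B21_b $ 2 $ 1 = 1" "B21_b $ 2 $ 2 = 0"
  "(mat 1 :: int^2^2) $ 1 $ 1 = 1" "(mat 1 :: int^2^2) $ 1 $ 2 = 0"
  "(mat 1 :: int^2^2) $ 2 $ 1 = 0" "(mat 1 :: int^2^2) $ 2 $ 2 = 1"
  by (simp_all add: B21_a_def B21_b_def mat_def)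

lemma mult_entry_2: "((x :: int^2^2) ** y) $ i $ j = x $ i $ 1 * y $ 1 $ j + x $ i $ 2 * y $ 2 $ j"
  by (simp add: matrix_matrix_mult_def sum_2)

lemma matrix_2_eq_iff: "(x :: int^2^2) = y \<longleftrightarrow>
  x $ 1 $ 1 = y $ 1 $ 1 \<and> x $ 1 $ 2 = y $ 1 $ 2 \<and> x $ 2 $ 1 = y $ 2 $ 1 \<and> x $ 2 $ 2 = y $ 2 $ 2"
  by (auto simp: vec_eq_iff forall_2)

text \<open>
  An element of \<open>B\<^sub>2\<^sup>1\<close> is a partial injection of a two-element set, read off from the ones of the
  matrix. Products become compositions, and since the order of \<open>B\<^sub>2\<^sup>1\<close> is reverse inclusion, joins
  become intersections.
\<close>

abbreviation B21_rel :: "int^2^2 \<Rightarrow> (2 \<times> 2) set" where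
  "B21_rel x \<equiv> {(i, j). x $ i $ j = 1}"

lemmas B21_calc = B21_entries mult_entry_2 matrix_2_eq_iff

lemma B21_carrier_cases:
  assumes "x \<in> B21_carrier"
  obtains "x = 0" | "x = mat 1" | "x = B21_a" | "x = B21_b" | "x = B21_a ** B21_b"
    | "x = B21_b ** B21_a"
  using assms by (auto simp: B21_carrier_def)

lemma B21_rel_eqs:
  "B21_rel 0 = {}" "B21_rel (mat 1) = {(1, 1), (2, 2)}" "B21_rel B21_a = {(1, 2)}"
  "B21_rel B21_b = {(2, 1)}" "B21_rel (B21_a ** B21_b) = {(1, 1)}"
  "B21_rel (B21_b ** B21_a) = {(2, 2)}"
  by (auto simp: set_eq_iff forall_2 split_paired_all B21_calc)

lemma B21_mul_closed: "\<lbrakk>x \<in> B21_carrier; y \<in> B21_carrier\<rbrakk> \<Longrightarrow> x ** y \<in> B21_carrier"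
  by (erule B21_carrier_cases; erule B21_carrier_cases)
    (simp_all add: B21_carrier_def B21_calc)

lemma ex_2: "(\<exists>k :: 2. P k) \<longleftrightarrow> P 1 \<or> P 2"
  by (metis exhaust_2)

lemma B21_rel_mul:
  "\<lbrakk>x \<in> B21_carrier; y \<in> B21_carrier\<rbrakk> \<Longrightarrow> B21_rel (x ** y) = B21_rel x O B21_rel y"
  by (erule B21_carrier_cases; erule B21_carrier_cases)
    (auto simp: set_eq_iff relcomp_unfold forall_2 ex_2 B21_calc)

lemma B21_rel_inj:
  "\<lbrakk>x \<in> B21_carrier; y \<in> B21_carrier; B21_rel x = B21_rel y\<rbrakk> \<Longrightarrow> x = y"
  by (erule B21_carrier_cases; erule B21_carrier_cases)
    (auto simp: B21_rel_eqs doubleton_eq_iff)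

lemma B21_le_iff:
  assumes "x \<in> B21_carrier" "y \<in> B21_carrier"
  shows "B21_le x y \<longleftrightarrow> B21_rel y \<subseteq> B21_rel x"
proof
  assume "B21_le x y"
  then have "(x, y) \<in> B21_covers\<^sup>*" by (simp add: B21_le_def)
  then show "B21_rel y \<subseteq> B21_rel x"
  proof (induction rule: rtrancl_induct)
    case (step y z)
    have "B21_rel z \<subseteq> B21_rel y"
      using step.hyps(2) unfolding B21_covers_def by (elim insertE emptyE Pair_inject; simp only: B21_rel_eqs) simp_all
    then show ?case using step.IH by blast
  qed simp
next
  have 1: "(mat 1, 0) \<in> B21_covers\<^sup>*"
    by (rule rtrancl_trans[OF r_into_rtrancl r_into_rtrancl, of _ "B21_a ** B21_b"])
      (simp_all add: B21_covers_def)
  have 2: "(u, w) \<in> B21_covers \<Longrightarrow> B21_le u w" for u w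
    by (simp add: B21_le_def r_into_rtrancl)
  have 3: "B21_le u u" for u
    by (simp add: B21_le_def)
  have 4: "B21_le (mat 1) 0"
    using 1 by (simp add: B21_le_def)
  have 5: "B21_le (mat 1) (B21_a ** B21_b)" "B21_le (mat 1) (B21_b ** B21_a)" "B21_le B21_a 0"
    "B21_le B21_b 0" "B21_le (B21_a ** B21_b) 0" "B21_le (B21_b ** B21_a) 0"
    by (rule 2, simp add: B21_covers_def)+
  show "B21_rel y \<subseteq> B21_rel x \<Longrightarrow> B21_le x y"
    using assms
    by (elim B21_carrier_cases; simp only: B21_rel_eqs;
        simp add: 3 4 5)
qed

lemma B21_add:
  assumes "x \<in> B21_carrier" "y \<in> B21_carrier"
  shows "sr_add B21 x y \<in> B21_carrier" "B21_rel (sr_add B21 x y) = B21_rel x \<inter> B21_rel y"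
proof -
  have "\<exists>z\<in>B21_carrier. B21_rel z = B21_rel x \<inter> B21_rel y"
    using assms
    by (elim B21_carrier_cases; simp only: B21_rel_eqs) (simp_all add: B21_carrier_def B21_rel_eqs)
  then obtain z where z: "z \<in> B21_carrier" "B21_rel z = B21_rel x \<inter> B21_rel y"
    by blast
  have "B21_is_join x y w \<longleftrightarrow> w = z" for w
  proof
    assume w: "B21_is_join x y w"
    then have wc: "w \<in> B21_carrier" by (simp add: B21_is_join_def)
    have "B21_le x z" "B21_le y z"
      using z assms by (simp_all only: B21_le_iff) auto
    then have "B21_le w z"
      using w z(1) by (simp add: B21_is_join_def)
    moreover have "B21_le x w" "B21_le y w"
      using w by (simp_all add: B21_is_join_def)
    ultimately have "B21_rel w = B21_rel z"
      using z wc assms by (simp only: B21_le_iff) blast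
    then show "w = z"
      using wc z(1) B21_rel_inj by blast
  next
    assume [simp]: "w = z"
    have "B21_le z t" if "t \<in> B21_carrier" "B21_le x t" "B21_le y t" for t
      using that z assms by (simp only: B21_le_iff) blast
    moreover have "B21_le x z" "B21_le y z"
      using z assms by (simp_all only: B21_le_iff) auto
    ultimately show "B21_is_join x y w"
      using z(1) by (simp add: B21_is_join_def)
  qed
  then have "sr_add B21 x y = z"
    by (auto simp: B21_def intro!: the_equality)
  then show "sr_add B21 x y \<in> B21_carrier" "B21_rel (sr_add B21 x y) = B21_rel x \<inter> B21_rel y"
    using z by simp_all
qed

primrec word_rel :: "(nat \<Rightarrow> int^2^2) \<Rightarrow> nat list \<Rightarrow> (2 \<times> 2) set" where
  "word_rel v [] = Id"
| "word_rel v (x # xs) = B21_rel (v x) O word_rel v xs"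

lemma word_rel_append: "word_rel v (xs @ ys) = word_rel v xs O word_rel v ys"
  by (induction xs) auto

lemma lang_nonempty: "lang t \<noteq> {}"
  by (induction t) auto

text \<open>
  Words denote partial injections. This is what makes composition distribute over intersection in
  \<open>B21_eval\<close> below, for the intermediate point of a composite is determined by either end.
\<close>

lemma word_rel_functional:
  assumes "range v \<subseteq> B21_carrier"
  shows "\<lbrakk>(i, j) \<in> word_rel v w; (i, j') \<in> word_rel v w\<rbrakk> \<Longrightarrow> j = j'"
    and "\<lbrakk>(i, j) \<in> word_rel v w; (i', j) \<in> word_rel v w\<rbrakk> \<Longrightarrow> i = i'"
proof -
  have "single_valued (B21_rel x) \<and> single_valued ((B21_rel x)\<inverse>)" if "x \<in> B21_carrier" for x
    using that
    by (elim B21_carrier_cases; simp only: B21_rel_eqs) (auto simp: single_valued_def)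
  then have "single_valued (B21_rel (v x)) \<and> single_valued ((B21_rel (v x))\<inverse>)" for x
    using assms by blast
  then have "single_valued (word_rel v w) \<and> single_valued ((word_rel v w)\<inverse>)"
    by (induction w) (simp_all add: single_valued_relcomp converse_relcomp)
  then show "\<lbrakk>(i, j) \<in> word_rel v w; (i, j') \<in> word_rel v w\<rbrakk> \<Longrightarrow> j = j'"
    and "\<lbrakk>(i, j) \<in> word_rel v w; (i', j) \<in> word_rel v w\<rbrakk> \<Longrightarrow> i = i'"
    by (auto simp: single_valued_def)
qed

lemma B21_eval:
  assumes v: "range v \<subseteq> B21_carrier"
  shows "sr_eval B21 v t \<in> B21_carrier \<and> B21_rel (sr_eval B21 v t) = (\<Inter>w\<in>lang t. word_rel v w)"
proof (induction t)
  case (Var i)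
  then show ?case using v by auto
next
  case (Plus t1 t2)
  have "B21_rel (sr_add B21 (sr_eval B21 v t1) (sr_eval B21 v t2))
      = (\<Inter>w\<in>lang t1. word_rel v w) \<inter> (\<Inter>w\<in>lang t2. word_rel v w)"
    using Plus.IH B21_add(2) by metis
  then show ?case using Plus.IH B21_add(1) by (simp add: INT_Un)
next
  case (Times t1 t2)
  have "(\<Inter>w\<in>lang t1. word_rel v w) O (\<Inter>w\<in>lang t2. word_rel v w)
      = (\<Inter>w\<in>lang (Times t1 t2). word_rel v w)" (is "?L = ?R")
  proof
    show "?L \<subseteq> ?R"
      by (fastforce simp: word_rel_append)
    show "?R \<subseteq> ?L"
    proof clarify
      fix i j
      assume ij: "(i, j) \<in> ?R"
      obtain w1 w2 where w: "w1 \<in> lang t1" "w2 \<in> lang t2"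
        using lang_nonempty by blast
      have *: "(i, j) \<in> word_rel v u1 O word_rel v u2" if "u1 \<in> lang t1" "u2 \<in> lang t2" for u1 u2
      proof -
        have "u1 @ u2 \<in> lang (Times t1 t2)" using that by auto
        then show ?thesis using ij by (metis INT_E word_rel_append)
      qed
      then obtain k where k: "(i, k) \<in> word_rel v w1" "(k, j) \<in> word_rel v w2"
        using w by blast
      have "(i, k) \<in> word_rel v u1" if "u1 \<in> lang t1" for u1
        using *[OF that w(2)] k(2) word_rel_functional(2)[OF v] by blast
      moreover have "(k, j) \<in> word_rel v u2" if "u2 \<in> lang t2" for u2
        using *[OF w(1) that] k(1) word_rel_functional(1)[OF v] by blast
      ultimately show "(i, j) \<in> ?L" by blast
    qed
  qed
  moreover have "B21_rel (sr_eval B21 v (Times t1 t2))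
      = B21_rel (sr_eval B21 v t1) O B21_rel (sr_eval B21 v t2)"
    using B21_rel_mul Times.IH by (simp add: B21_def)
  moreover have "sr_eval B21 v (Times t1 t2) \<in> B21_carrier"
    using B21_mul_closed Times.IH by (simp add: B21_def)
  ultimately show ?case
    using Times.IH by simp
qed

text \<open>
  If \<open>(i, j)\<close> is in the value of every rotation of a word, then each letter is defined at \<open>i\<close> and
  takes the value \<open>j\<close>. This lemma and the next list what is left: for \<open>i = j\<close> a partial identity
  containing \<open>(i, i)\<close>, and for \<open>i \<noteq> j\<close> either the identity or the single move from \<open>i\<close> to \<open>j\<close>.
\<close>

lemma B21_letter_loop:
  assumes "x \<in> B21_carrier" "(i, k) \<in> B21_rel x" "(k', i) \<in> B21_rel x"
  shows "(i, i) \<in> B21_rel x"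
  using assms by (elim B21_carrier_cases; simp only: B21_rel_eqs) auto

lemma B21_letter_move:
  assumes "x \<in> B21_carrier" "(i, k) \<in> B21_rel x" "(k', j) \<in> B21_rel x" "i \<noteq> j"
  shows "B21_rel x = {(i, j)} \<or> B21_rel x = Id"
  using assms exhaust_2
  by (elim B21_carrier_cases; simp only: B21_rel_eqs) (force simp: Id_def)+

lemma word_rel_loops:
  "\<forall>x\<in>set w. (i, i) \<in> B21_rel (v x) \<Longrightarrow> (i, i) \<in> word_rel v w"
  by (induction w) auto

text \<open>
  After one move from \<open>i\<close> to \<open>j\<close> a second one is undefined, so such words behave as in \<open>S\<^sub>7\<close> with the
  move in the place of \<open>a\<close>.
\<close>

lemma word_rel_moves:
  assumes "\<forall>x\<in>set w. B21_rel (v x) = {(i, j)} \<or> B21_rel (v x) = Id" and "i \<noteq> j"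
  shows "(i, j) \<in> word_rel v w \<longleftrightarrow> length (filter (\<lambda>x. (i, j) \<in> B21_rel (v x)) w) = 1"
proof -
  have "((i, j) \<in> word_rel v w \<longleftrightarrow> length (filter (\<lambda>x. (i, j) \<in> B21_rel (v x)) w) = 1) \<and>
    ((j, j) \<in> word_rel v w \<longleftrightarrow> length (filter (\<lambda>x. (i, j) \<in> B21_rel (v x)) w) = 0)"
    using assms(1)
  proof (induction w)
    case (Cons x w)
    have "B21_rel (v x) = {(i, j)} \<or> B21_rel (v x) = Id"
      using Cons.prems by simp
    then show ?case
    proof
      assume x: "B21_rel (v x) = {(i, j)}"
      then have "(i, j) \<in> B21_rel (v x)" by blast
      then show ?thesis
        using Cons assms(2) by (auto simp del: mem_Collect_eq case_prod_conv simp: x)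
    next
      assume x: "B21_rel (v x) = Id"
      then have "(i, j) \<notin> B21_rel (v x)" using assms(2) by blast
      then show ?thesis
        using Cons assms(2) by (auto simp del: mem_Collect_eq case_prod_conv simp: x)
    qed
  qed (use assms(2) in auto)
  then show ?thesis
    by blast
qed

lemma length_filter_upt:
  "length (filter P [0..<p]) = (\<Sum>i<p. if P i then 1 else 0)"
  by (induction p) auto

lemma B21_satisfies_grid_identity:
  assumes p: "2 \<le> p"
  shows "satisfies B21 {grid_identity p}"
proof -
  have main: "(\<Inter>w\<in>set (grid_words p). word_rel v w) \<subseteq> word_rel v (grid_column p (p - 1))"
    if v: "range v \<subseteq> B21_carrier" for v
  proof clarify
    fix s t
    assume "(s, t) \<in> (\<Inter>w\<in>set (grid_words p). word_rel v w)"
    then have st: "(s, t) \<in> word_rel v w" if "w \<in> set (grid_words p)" for w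
      using that by blast
    have row: "(s, t) \<in> word_rel v (rotate r (grid_row p i))" if "i < p" "r < p" for i r
      using st that by (auto simp: set_grid_words)
    have column: "(s, t) \<in> word_rel v (grid_column p j)" if "j < p - 1" for j
      using st that by (auto simp: set_grid_words)
    define c where "c i j = prod_encode (i, j)" for i j :: nat
    \<comment> \<open>Rotation by \<open>j\<close> brings the letter in column \<open>j\<close> to the front, and rotation by \<open>j + 1\<close> to the end.\<close>
    have first: "\<exists>k. (s, k) \<in> B21_rel (v (c i j))" if "i < p" "j < p" for i j
    proof -
      have "rotate j (grid_row p i) = c i j # tl (rotate j (grid_row p i))"
        using that p hd_rotate_conv_nth[of "grid_row p i" j] hd_Cons_tl[of "rotate j (grid_row p i)"]
        by (auto simp: grid_row_def c_def)
      then show ?thesis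
        using row[OF that] by (metis relcomp.cases word_rel.simps(2) prod.inject)
    qed
    have last: "\<exists>k. (k, t) \<in> B21_rel (v (c i j))" if "i < p" "j < p" for i j
    proof -
      have "rotate (Suc j) (grid_row p i) = tl (rotate j (grid_row p i)) @ [c i j]"
        using that p hd_rotate_conv_nth[of "grid_row p i" j]
        by (auto simp: grid_row_def c_def rotate1_hd_tl)
      moreover have "(s, t) \<in> word_rel v (rotate (Suc j) (grid_row p i))"
      proof (cases "Suc j < p")
        case True
        then show ?thesis using row that by blast
      next
        case False
        then have "rotate (Suc j) (grid_row p i) = rotate 0 (grid_row p i)"
          using that by (metis Suc_lessI diff_zero grid_row_def length_map length_upt
              rotate_conv_mod mod_self)
        then show ?thesis using row[OF that(1), of 0] p by simp
      qed
      ultimately show ?thesis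
        by (auto simp: word_rel_append)
    qed
    show "(s, t) \<in> word_rel v (grid_column p (p - 1))"
    proof (cases "s = t")
      case True
      have "(s, s) \<in> B21_rel (v (c i j))" if "i < p" "j < p" for i j
        using B21_letter_loop first[OF that] last[OF that] v True by blast
      then show ?thesis
        using True p by (auto intro!: word_rel_loops simp: grid_column_def c_def)
    next
      case False
      have cell: "B21_rel (v (c i j)) = {(s, t)} \<or> B21_rel (v (c i j)) = Id" if "i < p" "j < p" for i j
        using B21_letter_move first[OF that] last[OF that] v False by blast
      define P where "P x \<longleftrightarrow> (s, t) \<in> B21_rel (v x)" for x
      have count: "(s, t) \<in> word_rel v w \<longleftrightarrow> length (filter P w) = 1"
        if "set w \<subseteq> {c i j | i j. i < p \<and> j < p}" for w
        unfolding P_def by (rule word_rel_moves) (use that cell False in blast)+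
      \<comment> \<open>Count the moves in the grid by rows and by columns.\<close>
      define f where "f i j = (if P (c i j) then 1 else 0 :: nat)" for i j
      have "(\<Sum>j<p. f i j) = 1" if "i < p" for i
      proof -
        have "(s, t) \<in> word_rel v (grid_row p i)"
          using row[OF that, of 0] p by simp
        then show ?thesis
          using that by (subst (asm) count) (auto simp: grid_row_def c_def f_def length_filter_upt)
      qed
      then have "(\<Sum>i<p. \<Sum>j<p. f i j) = p"
        by simp
      moreover have "(\<Sum>i<p. f i j) = 1" if "j < p - 1" for j
        using column[OF that] that
        by (subst (asm) count) (auto simp: grid_column_def c_def f_def length_filter_upt)
      then have "(\<Sum>j<p - 1. \<Sum>i<p. f i j) = p - 1"
        by simp
      moreover have "(\<Sum>i<p. \<Sum>j<p. f i j) = (\<Sum>j<p - 1. \<Sum>i<p. f i j) + (\<Sum>i<p. f i (p - 1))"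
        using p by (subst sum.swap) (cases p; simp)
      ultimately have "(\<Sum>i<p. f i (p - 1)) = 1"
        using p by linarith
      then show ?thesis
        using p by (subst count) (auto simp: grid_column_def c_def f_def length_filter_upt)
    qed
  qed
  show ?thesis
    unfolding satisfies_def
  proof clarify
    fix s t and v :: "nat \<Rightarrow> int^2^2"
    assume st: "(s, t) = grid_identity p" and "range v \<subseteq> carrier B21"
    then have v: "range v \<subseteq> B21_carrier" by (simp add: B21_def)
    have "lang s = set (grid_words p)"
      "lang t = insert (grid_column p (p - 1)) (set (grid_words p))"
      using lang_grid_identity[OF p] st by (metis fst_conv, metis snd_conv)
    then have "B21_rel (sr_eval B21 v s) = B21_rel (sr_eval B21 v t)"
      using B21_eval[OF v] main[OF v] by auto
    then show "sr_eval B21 v s = sr_eval B21 v t"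
      using B21_rel_inj B21_eval[OF v] by blast
  qed
qed

section \<open>Syntactic algebras of sets of monomials\<close>

text \<open>
  A set \<open>L\<close> of target monomials in commuting letters induces a congruence on sets of monomials: two sets
  are congruent if the same contexts, which may be empty, multiply them into \<open>L\<close>. Each class has a
  largest member. These closed sets represent the quotient, and nonempty ones suffice because the
  signature has no constant for the empty sum.
\<close>

definition residuals :: "'b multiset set \<Rightarrow> 'b multiset set \<Rightarrow> 'b multiset set" where
  "residuals L X = {c. \<forall>x\<in>X. x + c \<in> L}"

definition syn_closure :: "'b multiset set \<Rightarrow> 'b multiset set \<Rightarrow> 'b multiset set" where
  "syn_closure L X = {w. w \<noteq> {#} \<and> (\<forall>c\<in>residuals L X. w + c \<in> L)}"

definition product_set :: "'b multiset set \<Rightarrow> 'b multiset set \<Rightarrow> 'b multiset set" where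
  "product_set X Y = (\<Union>x\<in>X. (+) x ` Y)"

definition syntactic_algebra :: "'b multiset set \<Rightarrow> 'b multiset set sr_alg" where
  "syntactic_algebra L = \<lparr>carrier = {X. X \<noteq> {} \<and> syn_closure L X = X},
     sr_add = (\<lambda>X Y. syn_closure L (X \<union> Y)),
     sr_mul = (\<lambda>X Y. syn_closure L (product_set X Y))\<rparr>"

lemma residuals_Un: "residuals L (X \<union> Y) = residuals L X \<inter> residuals L Y"
  by (auto simp: residuals_def)

lemma mem_product_set: "z \<in> product_set X Y \<longleftrightarrow> (\<exists>x\<in>X. \<exists>y\<in>Y. z = x + y)"
  by (auto simp: product_set_def)

lemma ball_product_set: "(\<forall>z\<in>product_set X Y. P z) \<longleftrightarrow> (\<forall>x\<in>X. \<forall>y\<in>Y. P (x + y))"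
  by (auto simp: product_set_def)

lemma bex_product_set: "(\<exists>z\<in>product_set X Y. P z) \<longleftrightarrow> (\<exists>x\<in>X. \<exists>y\<in>Y. P (x + y))"
  by (auto simp: product_set_def)

lemma residuals_product_set:
  "residuals L (product_set X Y) = {c. \<forall>x\<in>X. x + c \<in> residuals L Y}"
  by (simp add: residuals_def ball_product_set add.assoc add.left_commute)

lemma product_set_commute: "product_set X Y = product_set Y X"
  unfolding set_eq_iff mem_product_set by (metis add.commute)

lemma empty_notin_syn_closure: "{#} \<notin> syn_closure L X"
  by (simp add: syn_closure_def)

lemma syn_closure_increasing: "{#} \<notin> X \<Longrightarrow> X \<subseteq> syn_closure L X"
  by (auto simp: syn_closure_def residuals_def)

lemma residuals_syn_closure: "{#} \<notin> X \<Longrightarrow> residuals L (syn_closure L X) = residuals L X"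
  using syn_closure_increasing[of X L] by (auto simp: syn_closure_def residuals_def)

lemma syn_closure_eqI: "residuals L X = residuals L Y \<Longrightarrow> syn_closure L X = syn_closure L Y"
  by (simp add: syn_closure_def)

lemma syn_closure_eq_iff:
  "\<lbrakk>{#} \<notin> X; {#} \<notin> Y\<rbrakk> \<Longrightarrow> syn_closure L X = syn_closure L Y \<longleftrightarrow> residuals L X = residuals L Y"
  by (metis residuals_syn_closure syn_closure_eqI)

lemma syn_closure_mono: "X \<subseteq> Y \<Longrightarrow> syn_closure L X \<subseteq> syn_closure L Y"
  by (auto simp: syn_closure_def residuals_def)

lemma syn_closure_idem: "{#} \<notin> X \<Longrightarrow> syn_closure L (syn_closure L X) = syn_closure L X"
  by (intro syn_closure_eqI residuals_syn_closure)

lemma syn_closure_target: "syn_closure L L \<subseteq> L"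
proof -
  have "{#} \<in> residuals L L"
    by (simp add: residuals_def)
  then show ?thesis
    by (auto simp: syn_closure_def)
qed

lemma syn_closure_Un:
  assumes "{#} \<notin> X" "{#} \<notin> Y"
  shows "syn_closure L (syn_closure L X \<union> syn_closure L Y) = syn_closure L (X \<union> Y)"
  using assms by (intro syn_closure_eqI) (simp add: residuals_Un residuals_syn_closure)

text \<open>
  The closure operator is a nucleus: it may be applied to the factors of a product before the product is
  closed. Associativity and distributivity of the quotient come from this and from the corresponding
  law for unclosed sets.
\<close>

lemma syn_closure_product:
  assumes "{#} \<notin> X" "{#} \<notin> Y"
  shows "syn_closure L (product_set (syn_closure L X) (syn_closure L Y)) = syn_closure L (product_set X Y)"
proof (rule syn_closure_eqI)
  have "residuals L (product_set (syn_closure L X) (syn_closure L Y))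
      = residuals L (product_set (syn_closure L X) Y)"
    using assms by (simp add: residuals_product_set residuals_syn_closure)
  also have "\<dots> = residuals L (product_set Y (syn_closure L X))"
    by (simp add: product_set_commute)
  also have "\<dots> = residuals L (product_set Y X)"
    using assms by (simp add: residuals_product_set residuals_syn_closure)
  finally show "residuals L (product_set (syn_closure L X) (syn_closure L Y))
      = residuals L (product_set X Y)"
    by (simp add: product_set_commute)
qed

lemma empty_notin_product_set: "{#} \<notin> X \<Longrightarrow> {#} \<notin> product_set X Y"
  by (auto simp: mem_product_set)

lemma product_set_nonempty: "\<lbrakk>X \<noteq> {}; Y \<noteq> {}\<rbrakk> \<Longrightarrow> product_set X Y \<noteq> {}"
  by (auto simp: product_set_def)

lemma product_set_assoc: "product_set (product_set X Y) Z = product_set X (product_set Y Z)"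
  by (simp add: set_eq_iff mem_product_set bex_product_set add.assoc)

lemma product_set_Un: "product_set X (Y \<union> Z) = product_set X Y \<union> product_set X Z"
  by (auto simp: product_set_def)

lemma ai_semiring_syntactic_algebra:
  fixes L :: "'b multiset set"
  shows "ai_semiring (syntactic_algebra L)"
proof -
  define C where "C = carrier (syntactic_algebra L)"
  have C: "X \<noteq> {} \<and> {#} \<notin> X \<and> syn_closure L X = X" if "X \<in> C" for X
    using that empty_notin_syn_closure[of L X] by (auto simp: C_def syntactic_algebra_def)
  have clC: "syn_closure L X \<in> C" if "X \<noteq> {}" "{#} \<notin> X" for X
    using that syn_closure_increasing[of X L] syn_closure_idem[of X L]
    by (auto simp: C_def syntactic_algebra_def)
  have ops: "sr_add (syntactic_algebra L) X Y = syn_closure L (X \<union> Y)"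
    "sr_mul (syntactic_algebra L) X Y = syn_closure L (product_set X Y)" for X Y
    by (simp_all add: syntactic_algebra_def)
  have Un_l: "syn_closure L (syn_closure L X \<union> Y) = syn_closure L (X \<union> Y)"
    and Un_r: "syn_closure L (Y \<union> syn_closure L X) = syn_closure L (Y \<union> X)"
    and prod_l: "syn_closure L (product_set (syn_closure L X) Y) = syn_closure L (product_set X Y)"
    and prod_r: "syn_closure L (product_set Y (syn_closure L X)) = syn_closure L (product_set Y X)"
    if "{#} \<notin> X" "Y \<in> C" for X Y
    using that C[of Y] syn_closure_Un[of X Y L] syn_closure_Un[of Y X L]
      syn_closure_product[of X Y L] syn_closure_product[of Y X L] by simp_all
  show ?thesis
  proof (unfold_locales, fold C_def)
    show "C \<noteq> {}"
      using clC[of "{{#undefined#}}"] by auto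
  next
    fix X Y assume XY: "X \<in> C" "Y \<in> C"
    show "sr_add (syntactic_algebra L) X Y \<in> C"
      unfolding ops by (intro clC) (use C XY in blast)+
    show "sr_mul (syntactic_algebra L) X Y \<in> C"
      unfolding ops using C XY
      by (intro clC product_set_nonempty empty_notin_product_set) blast+
    show "sr_add (syntactic_algebra L) X Y = sr_add (syntactic_algebra L) Y X"
      by (simp add: ops Un_commute)
    show "sr_add (syntactic_algebra L) X X = X"
      using C[OF XY(1)] by (simp add: ops)
  next
    fix X Y Z assume XYZ: "X \<in> C" "Y \<in> C" "Z \<in> C"
    have no: "{#} \<notin> X \<union> Y" "{#} \<notin> Y \<union> Z" "{#} \<notin> product_set A B"
      if "A \<in> {X, Y, Z}" for A B
      using C[OF XYZ(1)] C[OF XYZ(2)] C[OF XYZ(3)] that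
      by (auto simp: mem_product_set)
    show "sr_add (syntactic_algebra L) (sr_add (syntactic_algebra L) X Y) Z
        = sr_add (syntactic_algebra L) X (sr_add (syntactic_algebra L) Y Z)"
      using XYZ no[of X] by (simp add: ops Un_l Un_r Un_assoc)
    show "sr_mul (syntactic_algebra L) (sr_mul (syntactic_algebra L) X Y) Z
        = sr_mul (syntactic_algebra L) X (sr_mul (syntactic_algebra L) Y Z)"
      using XYZ no by (simp add: ops prod_l prod_r product_set_assoc)
    have *: "sr_mul (syntactic_algebra L) X (sr_add (syntactic_algebra L) Y Z)
        = sr_add (syntactic_algebra L) (sr_mul (syntactic_algebra L) X Y) (sr_mul (syntactic_algebra L) X Z)"
      if "X \<in> C" "Y \<in> C" "Z \<in> C" for X Y Z
    proof -
      have n: "{#} \<notin> Y \<union> Z" "{#} \<notin> product_set X Y" "{#} \<notin> product_set X Z"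
        using C[OF that(1)] C[OF that(2)] C[OF that(3)] empty_notin_product_set by auto
      show ?thesis
        using n that by (simp add: ops prod_r product_set_Un syn_closure_Un)
    qed
    show "sr_mul (syntactic_algebra L) X (sr_add (syntactic_algebra L) Y Z)
        = sr_add (syntactic_algebra L) (sr_mul (syntactic_algebra L) X Y) (sr_mul (syntactic_algebra L) X Z)"
      using * XYZ by blast
    have "sr_mul (syntactic_algebra L) A B = sr_mul (syntactic_algebra L) B A" for A B
      by (simp add: ops product_set_commute)
    then show "sr_mul (syntactic_algebra L) (sr_add (syntactic_algebra L) X Y) Z
        = sr_add (syntactic_algebra L) (sr_mul (syntactic_algebra L) X Z) (sr_mul (syntactic_algebra L) Y Z)"
      using *[OF XYZ(3,1,2)] by metis
  qed
qed

primrec eval_set :: "(nat \<Rightarrow> 'b multiset set) \<Rightarrow> sr_term \<Rightarrow> 'b multiset set" where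
  "eval_set V (Var i) = V i"
| "eval_set V (Plus s t) = eval_set V s \<union> eval_set V t"
| "eval_set V (Times s t) = product_set (eval_set V s) (eval_set V t)"

lemma empty_notin_eval_set: "\<forall>i. {#} \<notin> V i \<Longrightarrow> {#} \<notin> eval_set V t"
  by (induction t) (auto simp: empty_notin_product_set)

lemma eval_set_nonempty: "\<forall>i. V i \<noteq> {} \<Longrightarrow> eval_set V t \<noteq> {}"
  by (induction t) (auto simp: product_set_nonempty)

lemma syn_closure_eval_set:
  assumes "\<forall>i. {#} \<notin> V i"
  shows "syn_closure L (eval_set (\<lambda>i. syn_closure L (V i)) t) = syn_closure L (eval_set V t)"
proof (induction t)
  case (Var i)
  then show ?case using assms by (simp add: syn_closure_idem)
next
  case (Plus s t)
  have n: "{#} \<notin> eval_set (\<lambda>i. syn_closure L (V i)) r" "{#} \<notin> eval_set V r" for r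
    using assms by (simp_all add: empty_notin_syn_closure empty_notin_eval_set)
  show ?case
    using syn_closure_Un[OF n(1) n(1), of L s t] syn_closure_Un[OF n(2) n(2), of L s t] Plus.IH
    by simp
next
  case (Times s t)
  have n: "{#} \<notin> eval_set (\<lambda>i. syn_closure L (V i)) r" "{#} \<notin> eval_set V r" for r
    using assms by (simp_all add: empty_notin_syn_closure empty_notin_eval_set)
  show ?case
    using syn_closure_product[OF n(1) n(1), of L s t] syn_closure_product[OF n(2) n(2), of L s t] Times.IH
    by simp
qed

lemma syntactic_algebra_carrierD:
  assumes "range V \<subseteq> carrier (syntactic_algebra L)"
  shows "V i \<noteq> {} \<and> {#} \<notin> V i \<and> syn_closure L (V i) = V i"
proof -
  have "V i \<in> carrier (syntactic_algebra L)"
    using assms by blast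
  then have "V i \<noteq> {} \<and> syn_closure L (V i) = V i"
    by (simp add: syntactic_algebra_def)
  then show ?thesis
    using empty_notin_syn_closure[of L "V i"] by metis
qed

lemma syntactic_algebra_eval:
  assumes "range V \<subseteq> carrier (syntactic_algebra L)"
  shows "sr_eval (syntactic_algebra L) V t = syn_closure L (eval_set V t)"
proof -
  have V: "V i \<noteq> {}" "{#} \<notin> V i" "syn_closure L (V i) = V i" for i
    using syntactic_algebra_carrierD[OF assms] by auto
  have n: "{#} \<notin> eval_set V r" for r
    using V(2) by (simp add: empty_notin_eval_set)
  show ?thesis
  proof (induction t)
    case (Var i)
    then show ?case using V by simp
  next
    case (Plus s t)
    then show ?case
      using syn_closure_Un[OF n n, of L s t] by (simp add: syntactic_algebra_def)
  next
    case (Times s t)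
    then show ?case
      using syn_closure_product[OF n n, of L s t] by (simp add: syntactic_algebra_def)
  qed
qed

text \<open>
  Two terms agree in the quotient as soon as their unclosed values have the same contexts, so closures
  are not needed when identities are checked.
\<close>

lemma syntactic_algebra_eval_eq_iff:
  assumes "range V \<subseteq> carrier (syntactic_algebra L)"
  shows "sr_eval (syntactic_algebra L) V s = sr_eval (syntactic_algebra L) V t
    \<longleftrightarrow> residuals L (eval_set V s) = residuals L (eval_set V t)"
proof -
  have "{#} \<notin> eval_set V r" for r
    using syntactic_algebra_carrierD[OF assms] by (simp add: empty_notin_eval_set)
  then show ?thesis
    using assms by (simp add: syntactic_algebra_eval syn_closure_eq_iff)
qed

primrec eval_word :: "(nat \<Rightarrow> 'b multiset set) \<Rightarrow> nat list \<Rightarrow> 'b multiset set" where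
  "eval_word V [] = {{#}}"
| "eval_word V (x # xs) = product_set (V x) (eval_word V xs)"

lemma eval_word_append: "eval_word V (xs @ ys) = product_set (eval_word V xs) (eval_word V ys)"
proof (induction xs)
  case Nil
  show ?case by (simp add: product_set_def)
next
  case (Cons x xs)
  then show ?case by (simp add: product_set_assoc)
qed

lemma eval_set_lang: "eval_set V t = (\<Union>w\<in>lang t. eval_word V w)"
proof (induction t)
  case (Times s t)
  have "(\<Union>w\<in>lang (Times s t). eval_word V w)
      = (\<Union>xs\<in>lang s. \<Union>ys\<in>lang t. product_set (eval_word V xs) (eval_word V ys))"
    by (auto simp flip: eval_word_append)
  also have "\<dots> = product_set (\<Union>xs\<in>lang s. eval_word V xs) (\<Union>ys\<in>lang t. eval_word V ys)"
    unfolding set_eq_iff UN_iff mem_product_set by blast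
  finally show ?case using Times.IH by simp
qed (auto simp: product_set_def)

lemma sum_list_in_eval_word:
  "\<forall>i. \<psi> i \<in> V i \<Longrightarrow> sum_list (map \<psi> w) \<in> eval_word V w"
  by (induction w) (auto simp: mem_product_set)

text \<open>
  In a word without repeated letters the factors of a product can be chosen independently, so that a
  single monomial for each letter describes the product. This reduces set-valued assignments to
  monomial-valued ones.
\<close>

lemma eval_word_distinctE:
  assumes "y \<in> eval_word V w" "distinct w" "\<forall>i. V i \<noteq> {}"
  obtains \<psi> where "\<forall>i. \<psi> i \<in> V i" "y = sum_list (map \<psi> w)"
proof -
  have "\<exists>\<psi>. (\<forall>i. \<psi> i \<in> V i) \<and> y = sum_list (map \<psi> w)"
    using assms(1,2)
  proof (induction w arbitrary: y)
    case Nil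
    have "\<forall>i. (SOME m. m \<in> V i) \<in> V i"
      using assms(3) by (simp add: some_in_eq)
    then show ?case
      using Nil by (intro exI[of _ "\<lambda>i. SOME m. m \<in> V i"]) simp
  next
    case (Cons a w)
    then obtain x z where xz: "x \<in> V a" "z \<in> eval_word V w" "y = x + z"
      by (auto simp: mem_product_set)
    then obtain \<psi> where \<psi>: "\<forall>i. \<psi> i \<in> V i" "z = sum_list (map \<psi> w)"
      using Cons by (metis distinct.simps(2))
    have "map (\<psi>(a := x)) w = map \<psi> w"
      using Cons.prems by auto
    then have "y = sum_list (map (\<psi>(a := x)) (a # w))"
      unfolding list.map sum_list.Cons xz(3) \<psi>(2) by (simp only: fun_upd_same)
    moreover have "\<forall>i. (\<psi>(a := x)) i \<in> V i"
      using xz(1) \<psi>(1) by simp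
    ultimately show ?case by blast
  qed
  then show thesis using that by blast
qed

section \<open>Identities of \<open>S\<^sub>7\<close> and of algebras with an adjoined zero\<close>

text \<open>
  For an additive count of letters, a set of monomials gets the value \<open>1\<close> if no monomial contains a
  counted letter, \<open>a\<close> if each contains exactly one, and \<open>0\<close> otherwise. This is a homomorphism to
  \<open>S\<^sub>7\<close>.
\<close>

definition s7_of_counts :: "nat set \<Rightarrow> s7" where
  "s7_of_counts N = (if N = {0} then S7_one else if N = {1} then S7_a else S7_zero)"

lemma s7_of_counts_Un:
  assumes "M \<noteq> {}" "N \<noteq> {}"
  shows "s7_of_counts (M \<union> N) = sr_add S7 (s7_of_counts M) (s7_of_counts N)"
proof -
  have Un: "M \<union> N = {k} \<longleftrightarrow> M = {k} \<and> N = {k}" for k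
    using assms by (simp add: Un_singleton_iff)
  show ?thesis
    unfolding s7_of_counts_def Un[of 0] Un[of 1]
    by (cases "M = {0}"; cases "M = {1}"; cases "N = {0}"; cases "N = {1}") (simp_all add: S7_def)
qed

lemma s7_of_counts_plus:
  assumes "M \<noteq> {}" "N \<noteq> {}"
  shows "s7_of_counts (\<Union>m\<in>M. (+) m ` N) = sr_mul S7 (s7_of_counts M) (s7_of_counts N)"
proof -
  let ?K = "\<Union>m\<in>M. (+) m ` N"
  obtain m0 n0 where mn: "m0 \<in> M" "n0 \<in> N" using assms by blast
  have determined: "M = {k - n0} \<and> N = {k - m0} \<and> m0 + n0 = k" if "?K = {k}" for k
  proof -
    have sum: "m + n = k" if "m \<in> M" "n \<in> N" for m n
      using \<open>?K = {k}\<close> that by blast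
    have "M \<subseteq> {k - n0}" "N \<subseteq> {k - m0}"
      using sum mn by fastforce+
    then have "M = {k - n0}" "N = {k - m0}"
      using mn by blast+
    then show ?thesis
      using sum[OF mn] by blast
  qed
  have 0: "?K = {0} \<longleftrightarrow> M = {0} \<and> N = {0}"
    using determined[of 0] by auto
  have 1: "?K = {1} \<longleftrightarrow> M = {0} \<and> N = {1} \<or> M = {1} \<and> N = {0}"
  proof
    assume "?K = {1}"
    then have *: "M = {1 - n0}" "N = {1 - m0}" "m0 + n0 = 1"
      using determined by blast+
    then have "m0 = 0 \<and> n0 = 1 \<or> m0 = 1 \<and> n0 = 0" by linarith
    then show "M = {0} \<and> N = {1} \<or> M = {1} \<and> N = {0}" using * by auto
  qed auto
  show ?thesis
    unfolding s7_of_counts_def 0 1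
    by (cases "M = {0}"; cases "M = {1}"; cases "N = {0}"; cases "N = {1}") (simp_all add: S7_def)
qed

text \<open>
  The number \<open>m\<close> is the count of a context. In a product with the context every count is one just in
  case the value in \<open>S\<^sub>7\<close> is \<open>a\<close> and \<open>m = 0\<close>, or it is \<open>1\<close> and \<open>m = 1\<close>, so the identity of \<open>S\<^sub>7\<close> decides.
\<close>

lemma S7_identity_preserves_exact_count:
  assumes "satisfies S7 {(s, t)}" and "\<forall>i. V i \<noteq> {}" and "\<And>x y. h (x + y) = h x + h y"
  shows "(\<forall>x\<in>eval_set V s. h x + m = 1) \<longleftrightarrow> (\<forall>x\<in>eval_set V t. h x + m = (1 :: nat))"
proof -
  have ev: "sr_eval S7 (\<lambda>i. s7_of_counts (h ` V i)) r = s7_of_counts (h ` eval_set V r)" for r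
  proof (induction r)
    case (Plus r1 r2)
    then show ?case
      using s7_of_counts_Un[of "h ` eval_set V r1" "h ` eval_set V r2"] eval_set_nonempty[OF assms(2)]
      by (simp add: image_Un)
  next
    case (Times r1 r2)
    have "h ` product_set (eval_set V r1) (eval_set V r2)
        = (\<Union>m\<in>h ` eval_set V r1. (+) m ` h ` eval_set V r2)"
      by (simp add: product_set_def image_UN image_image assms(3))
    then show ?case
      using s7_of_counts_plus[of "h ` eval_set V r1" "h ` eval_set V r2"]
        eval_set_nonempty[OF assms(2)] Times.IH
      by simp
  qed simp
  have "sr_eval S7 (\<lambda>i. s7_of_counts (h ` V i)) s = sr_eval S7 (\<lambda>i. s7_of_counts (h ` V i)) t"
    by (rule satisfies_singleD[OF assms(1)]) (simp add: S7_def)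
  then have "s7_of_counts (h ` eval_set V s) = s7_of_counts (h ` eval_set V t)"
    by (simp only: ev)
  then have same: "h ` eval_set V s = {k} \<longleftrightarrow> h ` eval_set V t = {k}" if "k \<le> 1" for k
  proof -
    have *: "N = {k} \<longleftrightarrow> s7_of_counts N = (if k = 0 then S7_one else S7_a)" for N
      using that by (auto simp: s7_of_counts_def)
    show ?thesis
      unfolding * \<open>s7_of_counts (h ` eval_set V s) = _\<close> ..
  qed
  have exact: "(\<forall>x\<in>eval_set V r. h x + m = 1) \<longleftrightarrow> m \<le> 1 \<and> h ` eval_set V r = {1 - m}" for r
  proof
    assume *: "\<forall>x\<in>eval_set V r. h x + m = 1"
    obtain x where x: "x \<in> eval_set V r"
      using eval_set_nonempty[OF assms(2)] by blast
    have eq: "h y = 1 - m" if "y \<in> eval_set V r" for y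
    proof -
      have "h y + m = 1" using * that by blast
      then show ?thesis by linarith
    qed
    have "h x + m = 1" using * x by blast
    then have "m \<le> 1" by linarith
    moreover have "h ` eval_set V r = {1 - m}"
      using x by (auto simp: eq image_iff intro: bexI[OF _ x])
    ultimately show "m \<le> 1 \<and> h ` eval_set V r = {1 - m}" by blast
  next
    assume *: "m \<le> 1 \<and> h ` eval_set V r = {1 - m}"
    show "\<forall>x\<in>eval_set V r. h x + m = 1"
    proof
      fix x assume "x \<in> eval_set V r"
      then have "h x = 1 - m" using * by blast
      then show "h x + m = 1" using * by linarith
    qed
  qed
  show ?thesis
    unfolding exact using same[of "1 - m"] by simp
qed

text \<open>
  Give a variable the value \<open>0\<close> if each of its monomials has a letter outside \<open>U\<close>, and a fixed element of
  \<open>S\<close> otherwise. Then a term is \<open>0\<close> in \<open>S\<^sup>0\<close> just in case no monomial of it lies within \<open>U\<close>,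
  whatever the operations of \<open>S\<close> are.
\<close>

lemma adjoin_zero_identity_preserves_content:
  assumes "satisfies (adjoin_zero S) {(s, t)}" and "ai_semiring S"
  shows "(\<exists>x\<in>eval_set V s. set_mset x \<subseteq> U) \<longleftrightarrow> (\<exists>x\<in>eval_set V t. set_mset x \<subseteq> U)"
proof -
  obtain e where e: "e \<in> carrier S"
    using assms(2) by (auto simp: ai_semiring_def)
  define v where "v i = (if \<exists>x\<in>V i. set_mset x \<subseteq> U then Some e else None)" for i
  have add: "sr_add (adjoin_zero S) a b = None \<longleftrightarrow> a = None \<and> b = None"
    and mul: "sr_mul (adjoin_zero S) a b = None \<longleftrightarrow> a = None \<or> b = None" for a b
    by (cases a; cases b; simp add: adjoin_zero_def)+
  have "sr_eval (adjoin_zero S) v r \<noteq> None \<longleftrightarrow> (\<exists>x\<in>eval_set V r. set_mset x \<subseteq> U)" for r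
  proof (induction r)
    case (Var i)
    then show ?case by (simp add: v_def)
  next
    case (Plus r1 r2)
    then show ?case by (auto simp: add)
  next
    case (Times r1 r2)
    have "(\<exists>x\<in>product_set X Y. set_mset x \<subseteq> U)
        \<longleftrightarrow> (\<exists>x\<in>X. set_mset x \<subseteq> U) \<and> (\<exists>x\<in>Y. set_mset x \<subseteq> U)" for X Y :: "'b multiset set"
      by (simp add: bex_product_set)
    then show ?case using Times by (simp add: mul)
  qed
  moreover have "range v \<subseteq> carrier (adjoin_zero S)"
    using e by (auto simp: v_def adjoin_zero_def)
  then have "sr_eval (adjoin_zero S) v s = sr_eval (adjoin_zero S) v t"
    by (rule satisfies_singleD[OF assms(1)])
  ultimately show ?thesis
    by metis
qed
section \<open>The grid algebras\<close>

text \<open>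
  Lines of the \<open>p\<close>-grid are indexed by \<open>Inl i\<close> for row \<open>i\<close> and \<open>Inr j\<close> for column \<open>j\<close>. The index set
  leaves out the last column, which is to be no target.
\<close>

definition line_indices :: "nat \<Rightarrow> (nat + nat) set" where
  "line_indices p = {..<p} <+> {..<p - 1}"

definition grid_line :: "nat \<Rightarrow> nat + nat \<Rightarrow> (nat \<times> nat) set" where
  "grid_line p m = (case m of Inl i \<Rightarrow> {i} \<times> {..<p} | Inr j \<Rightarrow> {..<p} \<times> {j})"

definition grid_monomials :: "nat \<Rightarrow> (nat \<times> nat) multiset set" where
  "grid_monomials p = (\<lambda>m. mset_set (grid_line p m)) ` line_indices p"

definition grid_algebra :: "nat \<Rightarrow> (nat \<times> nat) multiset set sr_alg" where
  "grid_algebra p = syntactic_algebra (grid_monomials p)"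

text \<open>
  The residue of \<open>i + j\<close> colours the cells as in a cyclic Latin square, so that each line contains each
  colour once.
\<close>

definition colour_count :: "nat \<Rightarrow> nat \<Rightarrow> (nat \<times> nat) multiset \<Rightarrow> nat" where
  "colour_count p k x = size (filter_mset (\<lambda>(i, j). (i + j) mod p = k) x)"

lemma finite_grid_line [simp]: "finite (grid_line p m)"
  by (simp add: grid_line_def split: sum.split)

lemma card_grid_line [simp]: "card (grid_line p m) = p"
  by (simp add: grid_line_def card_cartesian_product split: sum.split)

lemma card_shifted_residue:
  fixes i k p :: nat
  assumes "k < p"
  shows "card {j. j < p \<and> (i + j) mod p = k} = 1"
proof -
  let ?f = "\<lambda>j. (i + j) mod p"
  have le: "j = j'" if "j \<le> j'" "j' < p" "?f j = ?f j'" for j j'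
  proof -
    have "p dvd (i + j') - (i + j)"
      using that mod_eq_dvd_iff_nat[of "i + j" "i + j'" p] by simp
    then have "p dvd j' - j" by simp
    then show ?thesis
      using that nat_dvd_not_less[of "j' - j" p] by (cases "j = j'") auto
  qed
  have inj: "inj_on ?f {..<p}"
  proof (rule inj_onI)
    fix j j' assume "j \<in> {..<p}" "j' \<in> {..<p}" "?f j = ?f j'"
    then show "j = j'"
      using le[of j j'] le[of j' j] by (cases "j \<le> j'") auto
  qed
  have "?f ` {..<p} = {..<p}"
    using inj assms by (intro card_subset_eq) (auto simp: card_image)
  then obtain j where j: "j < p" "?f j = k"
    using assms by (metis (no_types, lifting) image_iff lessThan_iff)
  then have "{j. j < p \<and> ?f j = k} = {j}"
    using inj by (auto simp: inj_on_def)
  then show ?thesis by simp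
qed

lemma colour_count_grid_line:
  assumes "k < p"
  shows "colour_count p k (mset_set (grid_line p m)) = 1"
proof -
  have "colour_count p k (mset_set (grid_line p m)) = card {x \<in> grid_line p m. (fst x + snd x) mod p = k}"
    by (simp add: colour_count_def filter_mset_mset_set case_prod_beta)
  also have "\<dots> = 1"
  proof (cases m)
    case (Inl i)
    have "{x \<in> grid_line p m. (fst x + snd x) mod p = k} = Pair i ` {j. j < p \<and> (i + j) mod p = k}"
      by (auto simp: grid_line_def Inl)
    then show ?thesis
      using card_shifted_residue[OF assms, of i] by (simp add: card_image inj_on_def)
  next
    case (Inr j)
    have "{x \<in> grid_line p m. (fst x + snd x) mod p = k}
        = (\<lambda>i. (i, j)) ` {i. i < p \<and> (j + i) mod p = k}"
      by (auto simp: grid_line_def Inr add.commute)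
    then show ?thesis
      using card_shifted_residue[OF assms, of j] by (simp add: card_image inj_on_def)
  qed
  finally show ?thesis .
qed

lemma sum_colour_count:
  assumes "0 < p"
  shows "(\<Sum>k<p. colour_count p k x) = size x"
proof (induction x)
  case empty
  then show ?case by (simp add: colour_count_def)
next
  case (add a x)
  have "colour_count p k (add_mset a x)
      = (if (fst a + snd a) mod p = k then 1 else 0) + colour_count p k x" for k
    by (simp add: colour_count_def case_prod_beta)
  then show ?case
    using add assms by (simp add: sum.distrib)
qed

lemma colour_count_plus: "colour_count p k (x + y) = colour_count p k x + colour_count p k y"
  by (simp add: colour_count_def)

text \<open>
  The colours force a monomial to have degree \<open>p\<close>, and then it cannot be more than the line that it
  contains. The point of this description is that exact colour counts are controlled by the identities
  of \<open>S\<^sub>7\<close>, and the letters of a monomial by the identities of \<open>S\<^sup>0\<close>.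
\<close>

lemma grid_monomials_iff:
  assumes "0 < p"
  shows "x \<in> grid_monomials p \<longleftrightarrow>
    (\<forall>k<p. colour_count p k x = 1) \<and> (\<exists>m\<in>line_indices p. grid_line p m \<subseteq> set_mset x)"
proof
  assume "x \<in> grid_monomials p"
  then show "(\<forall>k<p. colour_count p k x = 1) \<and> (\<exists>m\<in>line_indices p. grid_line p m \<subseteq> set_mset x)"
    using colour_count_grid_line by (auto simp: grid_monomials_def)
next
  assume *: "(\<forall>k<p. colour_count p k x = 1) \<and> (\<exists>m\<in>line_indices p. grid_line p m \<subseteq> set_mset x)"
  then obtain m where m: "m \<in> line_indices p" "grid_line p m \<subseteq> set_mset x" by blast
  have "size x = p"
    using sum_colour_count[OF assms, of x] * by simp
  moreover have "mset_set (grid_line p m) \<subseteq># x"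
    by (rule subset_mset.order_trans[OF subset_imp_msubset_mset_set[OF m(2)] mset_set_set_mset_msubset])
      simp
  ultimately have "mset_set (grid_line p m) = x"
    by (metis card_grid_line mset_subset_size nat_neq_iff size_mset_set subset_mset.le_imp_less_or_eq)
  then show "x \<in> grid_monomials p"
    using m(1) by (auto simp: grid_monomials_def)
qed

lemma size_grid_monomial: "x \<in> grid_monomials p \<Longrightarrow> size x = p"
  by (auto simp: grid_monomials_def)

lemma grid_algebra_satisfies:
  assumes "0 < p" "ai_semiring S" "satisfies S7 {(s, t)}" "satisfies (adjoin_zero S) {(s, t)}"
  shows "satisfies (grid_algebra p) {(s, t)}"
  unfolding satisfies_def
proof clarsimp
  fix V :: "nat \<Rightarrow> (nat \<times> nat) multiset set"
  assume V: "range V \<subseteq> carrier (grid_algebra p)"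
  then have ne: "\<forall>i. V i \<noteq> {}"
    unfolding grid_algebra_def by (blast dest: syntactic_algebra_carrierD)
  let ?X = "eval_set V"
  have sub: "c \<in> residuals (grid_monomials p) (?X b)"
    if c: "c \<in> residuals (grid_monomials p) (?X a)" and
      ab: "\<And>h m. (\<And>x y. h (x + y) = h x + h y) \<Longrightarrow>
        (\<forall>x\<in>?X a. h x + m = 1) \<longleftrightarrow> (\<forall>x\<in>?X b. h x + m = (1 :: nat))"
        "\<And>U. (\<exists>x\<in>?X a. set_mset x \<subseteq> U) \<longleftrightarrow> (\<exists>x\<in>?X b. set_mset x \<subseteq> U)"
    for a b c
  proof -
    have "x + c \<in> grid_monomials p" if x: "x \<in> ?X b" for x
    proof -
      have all: "(\<forall>k<p. colour_count p k y + colour_count p k c = 1) \<and>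
          (\<exists>m\<in>line_indices p. grid_line p m \<subseteq> set_mset y \<union> set_mset c)" if "y \<in> ?X a" for y
        using c that by (simp add: residuals_def grid_monomials_iff[OF assms(1)] colour_count_plus)
      have "colour_count p k x + colour_count p k c = 1" if "k < p" for k
        using ab(1)[of "colour_count p k" "colour_count p k c"] all x that
        by (simp add: colour_count_plus)
      \<comment> \<open>If \<open>x + c\<close> contained no line, then neither would any product of \<open>c\<close> with a monomial in these letters.\<close>
      moreover obtain y where y: "y \<in> ?X a" "set_mset y \<subseteq> set_mset x \<union> set_mset c"
        using ab(2)[of "set_mset x \<union> set_mset c"] x by blast
      moreover obtain m where "m \<in> line_indices p" "grid_line p m \<subseteq> set_mset y \<union> set_mset c"
        using all[OF y(1)] by blast
      ultimately show ?thesis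
        by (auto simp: grid_monomials_iff[OF assms(1)] colour_count_plus)
    qed
    then show ?thesis by (simp add: residuals_def)
  qed
  have "residuals (grid_monomials p) (?X s) = residuals (grid_monomials p) (?X t)"
  proof (intro subset_antisym subsetI)
    fix c
    assume "c \<in> residuals (grid_monomials p) (?X s)"
    then show "c \<in> residuals (grid_monomials p) (?X t)"
      by (rule sub[OF _ S7_identity_preserves_exact_count[OF assms(3) ne]
            adjoin_zero_identity_preserves_content[OF assms(4,2)]])
  next
    fix c
    assume "c \<in> residuals (grid_monomials p) (?X t)"
    then show "c \<in> residuals (grid_monomials p) (?X s)"
      by (rule sub[OF _ S7_identity_preserves_exact_count[OF assms(3) ne, symmetric]
            adjoin_zero_identity_preserves_content[OF assms(4,2), symmetric]])
  qed
  then show "sr_eval (grid_algebra p) V s = sr_eval (grid_algebra p) V t"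
    using V unfolding grid_algebra_def by (simp add: syntactic_algebra_eval_eq_iff)
qed

lemma sum_list_map_upt: "sum_list (map f [0..<n]) = (\<Sum>i<n. f i)"
  by (induction n) (simp_all add: add.commute)

lemma sum_list_grid_row:
  "sum_list (map \<psi> (grid_row p i)) = (\<Sum>j<p. \<psi> (prod_encode (i, j)))"
  by (simp add: grid_row_def comp_def sum_list_map_upt)

lemma sum_list_grid_column:
  "sum_list (map \<psi> (grid_column p j)) = (\<Sum>i<p. \<psi> (prod_encode (i, j)))"
  by (simp add: grid_column_def comp_def sum_list_map_upt)

lemma mset_rotate:
  fixes w :: "'c list"
  shows "mset (rotate r w) = mset w"
proof (induction r)
  case (Suc r)
  have "mset (rotate1 u) = mset u" for u :: "'c list"
    by (cases u) simp_all
  then show ?case using Suc by simp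
qed simp

lemma eval_word_letters:
  "eval_word (\<lambda>n. {{#prod_decode n#}}) w = {image_mset prod_decode (mset w)}"
  by (induction w) (simp_all add: product_set_def)

lemma mset_grid_row: "image_mset prod_decode (mset (grid_row p i)) = mset_set (grid_line p (Inl i))"
proof -
  have "map prod_decode (grid_row p i) = map (Pair i) [0..<p]"
    by (simp add: grid_row_def)
  moreover have "set (map (Pair i) [0..<p]) = grid_line p (Inl i)"
    by (auto simp: grid_line_def)
  moreover have "distinct (map (Pair i) [0..<p])"
    by (simp add: distinct_map inj_on_def)
  ultimately show ?thesis
    by (metis mset_map mset_set_set)
qed

lemma mset_grid_column:
  "image_mset prod_decode (mset (grid_column p j)) = mset_set (grid_line p (Inr j))"
proof -
  have "map prod_decode (grid_column p j) = map (\<lambda>i. (i, j)) [0..<p]"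
    by (simp add: grid_column_def)
  moreover have "set (map (\<lambda>i. (i, j)) [0..<p]) = grid_line p (Inr j)"
    by (auto simp: grid_line_def)
  moreover have "distinct (map (\<lambda>i. (i, j)) [0..<p])"
    by (simp add: distinct_map inj_on_def)
  ultimately show ?thesis
    by (metis mset_map mset_set_set)
qed

text \<open>
  Assign to each variable the closure of its own cell. The words on the smaller side then take values
  in the targets, whereas the last column is not a target, as it has two cells in a column that is no
  target line.
\<close>

lemma grid_algebra_fails:
  assumes p: "2 \<le> p"
  shows "\<not> satisfies (grid_algebra p) {grid_identity p}"
proof
  assume sat: "satisfies (grid_algebra p) {grid_identity p}"
  let ?L = "grid_monomials p" and ?V = "\<lambda>n. {{#prod_decode n#}}"
  obtain s t where st: "grid_identity p = (s, t)"
    by fastforce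
  have lang: "lang s = set (grid_words p)" "lang t = insert (grid_column p (p - 1)) (set (grid_words p))"
    using lang_grid_identity[OF p] by (simp_all add: st)
  have "eval_set ?V s \<subseteq> ?L"
    by (auto simp: eval_set_lang lang eval_word_letters set_grid_words mset_rotate mset_grid_row mset_grid_column
        grid_monomials_def line_indices_def)
  moreover have n: "\<forall>i. {#} \<notin> ?V i"
    by simp
  define W where "W i = syn_closure ?L (?V i)" for i
  have "range W \<subseteq> carrier (grid_algebra p)"
    using syn_closure_increasing[of "?V _" ?L] syn_closure_idem[of "?V _" ?L]
    by (auto simp: W_def grid_algebra_def syntactic_algebra_def)
  then have "syn_closure ?L (eval_set W s) = syn_closure ?L (eval_set W t)"
    using sat unfolding st grid_algebra_def
    by (metis satisfies_singleD syntactic_algebra_eval)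
  then have "syn_closure ?L (eval_set ?V s) = syn_closure ?L (eval_set ?V t)"
    unfolding W_def using syn_closure_eval_set[OF n, of ?L] by simp
  moreover have "mset_set (grid_line p (Inr (p - 1))) \<in> eval_set ?V t"
    by (simp add: eval_set_lang lang eval_word_letters mset_grid_column)
  then have "mset_set (grid_line p (Inr (p - 1))) \<in> syn_closure ?L (eval_set ?V t)"
    using syn_closure_increasing[OF empty_notin_eval_set[OF n], of t ?L] by blast
  ultimately have "mset_set (grid_line p (Inr (p - 1))) \<in> ?L"
    using syn_closure_mono[of "eval_set ?V s" ?L ?L] syn_closure_target[of ?L] by blast
  then obtain m where m: "m \<in> line_indices p"
    "mset_set (grid_line p (Inr (p - 1))) = mset_set (grid_line p m)"
    unfolding grid_monomials_def by blast
  have eq: "grid_line p (Inr (p - 1)) = grid_line p m"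
    using arg_cong[OF m(2), of set_mset] by simp
  have "(0, p - 1) \<in> grid_line p m" "(1, p - 1) \<in> grid_line p m"
    using p unfolding eq[symmetric] by (simp_all add: grid_line_def)
  then show False
    using m(1) by (auto simp: grid_line_def line_indices_def)
qed

lemma sum_one_nonneg_int:
  fixes z :: "'i \<Rightarrow> int"
  assumes "finite I" "\<And>m. m \<in> I \<Longrightarrow> 0 \<le> z m" "sum z I = 1"
  obtains m0 where "m0 \<in> I" "\<And>m. m \<in> I \<Longrightarrow> z m = (if m = m0 then 1 else 0)"
proof -
  obtain m0 where m0: "m0 \<in> I" "z m0 \<noteq> 0"
    using assms(3) by (metis sum.neutral zero_neq_one)
  have s: "sum z I = z m0 + sum z (I - {m0})"
    using assms(1) m0(1) by (simp add: sum.remove)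
  have "0 \<le> sum z (I - {m0})"
    using assms(2) by (intro sum_nonneg) auto
  then have "z m0 = 1" "sum z (I - {m0}) = 0"
    using s assms(2)[OF m0(1)] assms(3) m0(2) by linarith+
  moreover have "\<forall>m\<in>I - {m0}. z m = 0"
    using calculation(2) sum_nonneg_eq_0_iff[of "I - {m0}" z] assms(1,2) by simp
  ultimately show thesis
    using that[OF m0(1)] by auto
qed

text \<open>
  Here \<open>\<psi>\<close> places monomials in the cells of a \<open>q\<close>-grid and \<open>c\<close> is a context. Adding up rows and columns
  expresses the monomial \<open>W\<close> of the last column as an integer combination \<open>z\<close> of lines with coefficient
  sum one. In the last column of the \<open>p\<close>-grid only rows contribute to \<open>W\<close>, so the coefficients of rows
  are nonnegative. As \<open>q < p\<close>, some row is not the image of a row and has coefficient zero; in that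
  row the exponents of \<open>W\<close> are the coefficients of the columns, so these are nonnegative as well.
  Hence \<open>W\<close> is a single line.
\<close>

lemma smaller_grid_closed:
  fixes \<psi> :: "nat \<Rightarrow> nat \<Rightarrow> (nat \<times> nat) multiset"
  assumes q: "1 \<le> q" "q < p"
    and rows: "\<And>i. i < q \<Longrightarrow> (\<Sum>j<q. \<psi> i j) + c \<in> grid_monomials p"
    and columns: "\<And>j. j < q - 1 \<Longrightarrow> (\<Sum>i<q. \<psi> i j) + c \<in> grid_monomials p"
  shows "(\<Sum>i<q. \<psi> i (q - 1)) + c \<in> grid_monomials p"
proof -
  define W where "W = (\<Sum>i<q. \<psi> i (q - 1)) + c"
  define I where "I = line_indices p"
  have [simp]: "finite I" by (simp add: I_def line_indices_def)
  have "\<forall>i\<in>{..<q}. \<exists>m\<in>I. (\<Sum>j<q. \<psi> i j) + c = mset_set (grid_line p m)"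
    using rows unfolding grid_monomials_def I_def by blast
  then obtain \<rho> where \<rho>: "\<And>i. i < q \<Longrightarrow> \<rho> i \<in> I"
    "\<And>i. i < q \<Longrightarrow> (\<Sum>j<q. \<psi> i j) + c = mset_set (grid_line p (\<rho> i))"
    by (metis lessThan_iff)
  have "\<forall>j\<in>{..<q - 1}. \<exists>m\<in>I. (\<Sum>i<q. \<psi> i j) + c = mset_set (grid_line p m)"
    using columns unfolding grid_monomials_def I_def by blast
  then obtain \<gamma> where \<gamma>: "\<And>j. j < q - 1 \<Longrightarrow> \<gamma> j \<in> I"
    "\<And>j. j < q - 1 \<Longrightarrow> (\<Sum>i<q. \<psi> i j) + c = mset_set (grid_line p (\<gamma> j))"
    by (metis lessThan_iff)
  have "(\<Sum>i<q. (\<Sum>j<q. \<psi> i j) + c) = (\<Sum>j<q. (\<Sum>i<q. \<psi> i j) + c)"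
    unfolding sum.distrib by (subst sum.swap) simp
  also have "\<dots> = (\<Sum>j<q - 1. (\<Sum>i<q. \<psi> i j) + c) + W"
    using q(1) by (cases q) (simp_all add: W_def)
  finally have eq: "(\<Sum>i<q. mset_set (grid_line p (\<rho> i))) = (\<Sum>j<q - 1. mset_set (grid_line p (\<gamma> j))) + W"
    using \<rho>(2) \<gamma>(2) by simp
  define z :: "nat + nat \<Rightarrow> int" where
    "z m = (\<Sum>i<q. if \<rho> i = m then 1 else 0) - (\<Sum>j<q - 1. if \<gamma> j = m then 1 else 0)" for m
  have z: "(\<Sum>m\<in>I. z m * f m) = (\<Sum>i<q. f (\<rho> i)) - (\<Sum>j<q - 1. f (\<gamma> j))" for f
  proof -
    have *: "(\<Sum>m\<in>I. (\<Sum>i<n. if g i = m then 1 else 0) * f m) = (\<Sum>i<n. f (g i))"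
      if "\<And>i. i < n \<Longrightarrow> g i \<in> I" for n and g :: "nat \<Rightarrow> nat + nat"
    proof -
      have "(\<Sum>m\<in>I. (\<Sum>i<n. if g i = m then 1 else 0) * f m)
          = (\<Sum>i<n. \<Sum>m\<in>I. if g i = m then f m else 0)"
        by (subst sum.swap) (auto simp: sum_distrib_right intro!: sum.cong)
      also have "\<dots> = (\<Sum>i<n. f (g i))"
        using that by (intro sum.cong) auto
      finally show ?thesis .
    qed
    show ?thesis
      using *[of q \<rho>] *[of "q - 1" \<gamma>] \<rho>(1) \<gamma>(1)
      by (simp add: z_def left_diff_distrib sum_subtractf)
  qed
  define on where "on x m = (if x \<in> grid_line p m then 1 else 0 :: int)" for x m
  have count: "int (count W x) = (\<Sum>m\<in>I. z m * on x m)" for x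
  proof -
    have "int (count (\<Sum>i<n. mset_set (grid_line p (g i))) x) = (\<Sum>i<n. on x (g i))"
      for n and g :: "nat \<Rightarrow> nat + nat"
      by (induction n) (simp_all add: on_def count_mset_set')
    then show ?thesis
      using arg_cong[OF eq, of "\<lambda>M. int (count M x)"] z[of "on x"] by simp
  qed
  \<comment> \<open>A cell lies on its row and on its column, unless the latter is the last one.\<close>
  have cell: "int (count W (k, l)) = z (Inl k) + (if l < p - 1 then z (Inr l) else 0)"
    if "k < p" "l < p" for k l
  proof -
    have "on (k, l) (Inl i) = (if i = k then 1 else 0)" "on (k, l) (Inr j) = (if j = l then 1 else 0)"
      for i j
      using that by (auto simp: on_def grid_line_def)
    then have "(\<Sum>m\<in>I. z m * on (k, l) m)
        = (\<Sum>i<p. if i = k then z (Inl i) else 0) + (\<Sum>j<p - 1. if j = l then z (Inr j) else 0)"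
      unfolding I_def line_indices_def
      by (simp add: sum.Plus comp_def if_distrib[of "\<lambda>a. z _ * a"] cong: if_cong)
    then show ?thesis
      using that by (simp add: count)
  qed
  have row_nonneg: "0 \<le> z (Inl k)" if "k < p" for k
    using cell[of k "p - 1"] that by simp
  have "\<exists>k<p. \<forall>i<q. \<rho> i \<noteq> Inl k"
  proof (rule ccontr)
    assume all_hit: "\<not> (\<exists>k<p. \<forall>i<q. \<rho> i \<noteq> Inl k)"
    have "Inl k \<in> \<rho> ` {..<q}" if k: "k < p" for k
    proof -
      obtain i where "i < q" "\<rho> i = Inl k"
        using all_hit k by blast
      then show ?thesis
        by (intro image_eqI[of _ _ i]) simp_all
    qed
    then have "Inl ` {..<p} \<subseteq> \<rho> ` {..<q}"
      by (intro image_subsetI) simp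
    then have "card (Inl ` {..<p} :: (nat + nat) set) \<le> card (\<rho> ` {..<q})"
      by (intro card_mono) auto
    also have "\<dots> \<le> q"
      using card_image_le[of "{..<q}" \<rho>] by simp
    finally show False
      using q(2) by (simp add: card_image)
  qed
  then obtain k where k: "k < p" "\<And>i. i < q \<Longrightarrow> \<rho> i \<noteq> Inl k" by blast
  have "z (Inl k) \<le> 0"
    using k(2) by (simp add: z_def sum_nonneg)
  then have "0 \<le> z (Inr l)" if "l < p - 1" for l
    using cell[of k l] k(1) that row_nonneg[OF k(1)] by (cases "l < p") auto
  then have "0 \<le> z m" if "m \<in> I" for m
    using that row_nonneg by (auto simp: I_def line_indices_def)
  moreover have "sum z I = 1"
    using z[of "\<lambda>_. 1"] q(1) by simp
  ultimately obtain m0 where m0: "m0 \<in> I" "\<And>m. m \<in> I \<Longrightarrow> z m = (if m = m0 then 1 else 0)"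
    using sum_one_nonneg_int[of I z] by auto
  have "int (count W x) = on x m0" for x
  proof -
    have "(\<Sum>m\<in>I. z m * on x m) = (\<Sum>m\<in>I. if m = m0 then on x m else 0)"
      using m0(2) by (intro sum.cong) auto
    then show ?thesis
      using m0(1) by (simp add: count)
  qed
  then have "W = mset_set (grid_line p m0)"
    by (intro multiset_eqI) (smt (verit) on_def count_mset_set' finite_grid_line of_nat_0 of_nat_1 of_nat_eq_iff)
  then show ?thesis
    using m0(1) unfolding W_def[symmetric] grid_monomials_def I_def by blast
qed

lemma length_le_size_sum_list: "\<forall>i. \<psi> i \<noteq> {#} \<Longrightarrow> length w \<le> size (sum_list (map \<psi> w))"
proof (induction w)
  case (Cons a w)
  then have "1 \<le> size (\<psi> a)" by (simp add: Suc_le_eq nonempty_has_size)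
  then show ?case using Cons by simp
qed simp

lemma grid_algebra_satisfies_other:
  assumes "2 \<le> q" "p \<noteq> q"
  shows "satisfies (grid_algebra p) {grid_identity q}"
proof -
  obtain s t where st: "grid_identity q = (s, t)"
    by fastforce
  have lang: "lang s = set (grid_words q)" "lang t = insert (grid_column q (q - 1)) (set (grid_words q))"
    using lang_grid_identity[OF assms(1)] by (simp_all add: st)
  have "sr_eval (grid_algebra p) V s = sr_eval (grid_algebra p) V t"
    if V: "range V \<subseteq> carrier (grid_algebra p)" for V
  proof -
    let ?L = "grid_monomials p"
    have V': "V i \<noteq> {}" "{#} \<notin> V i" for i
      using syntactic_algebra_carrierD[OF V[unfolded grid_algebra_def]] by auto
    have "y + c \<in> ?L"
      if c: "c \<in> residuals ?L (eval_set V s)" and y: "y \<in> eval_word V (grid_column q (q - 1))" for c y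
    proof -
      have "distinct (grid_column q (q - 1))"
        by (simp add: grid_column_def distinct_map inj_on_def)
      then obtain \<psi> where \<psi>: "\<forall>i. \<psi> i \<in> V i" "y = sum_list (map \<psi> (grid_column q (q - 1)))"
        using eval_word_distinctE[OF y] V'(1) by blast
      have w: "sum_list (map \<psi> w) + c \<in> ?L" if "w \<in> set (grid_words q)" for w
        using c sum_list_in_eval_word[OF \<psi>(1), of w] that
        by (auto simp: residuals_def eval_set_lang lang)
      have row: "(\<Sum>j<q. \<psi> (prod_encode (i, j))) + c \<in> ?L" if "i < q" for i
      proof -
        have "rotate 0 (grid_row q i) \<in> set (grid_words q)"
          unfolding set_grid_words using that assms(1)
          by (intro UnI1 CollectI exI[of _ i] exI[of _ 0]) simp
        then show ?thesis
          using w[of "grid_row q i"] by (simp add: sum_list_grid_row)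
      qed
      have column: "(\<Sum>i<q. \<psi> (prod_encode (i, j))) + c \<in> ?L" if "j < q - 1" for j
        using w[of "grid_column q j"] that by (simp add: set_grid_words sum_list_grid_column)
      show ?thesis
      proof (cases "q < p")
        case True
        then show ?thesis
          using smaller_grid_closed[of q p "\<lambda>i j. \<psi> (prod_encode (i, j))" c] row column assms(1)
          by (simp add: \<psi>(2) sum_list_grid_column)
      next
        case False
        have "\<psi> i \<noteq> {#}" for i
          using \<psi>(1) V'(2) by metis
        then have "q \<le> size (sum_list (map \<psi> (grid_row q 0)))"
          using length_le_size_sum_list[of \<psi> "grid_row q 0"] by (simp add: grid_row_def)
        moreover have "size (sum_list (map \<psi> (grid_row q 0)) + c) = p"
          using row[of 0] assms(1) by (intro size_grid_monomial) (simp add: sum_list_grid_row)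
        ultimately show ?thesis
          using False assms(2) by simp
      qed
    qed
    then have "residuals ?L (eval_set V s) = residuals ?L (eval_set V t)"
      by (auto simp: eval_set_lang lang residuals_def)
    then show ?thesis
      using V unfolding grid_algebra_def by (simp add: syntactic_algebra_eval_eq_iff)
  qed
  then show ?thesis
    by (auto simp: satisfies_def st)
qed

section \<open>The interval\<close>

theorem corollary3p7:
  fixes S :: "'a sr_alg"
  assumes "infinite (UNIV :: 'u set)"
    and "ai_semiring S"
    and "(gen_variety S7 :: 'u sr_alg set) \<subseteq> gen_variety S"
    and "(gen_variety S :: 'u sr_alg set) \<subseteq> gen_variety B21"
  shows "(variety_interval (gen_variety S) (gen_variety (adjoin_zero S)) :: 'u sr_alg set set)
           \<approx> (UNIV :: nat set set)"
proof (rule lepoll_antisym)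
  show "(variety_interval (gen_variety S) (gen_variety (adjoin_zero S)) :: 'u sr_alg set set)
      \<lesssim> (UNIV :: nat set set)"
    by (rule lepoll_trans[OF subset_imp_lepoll varieties_lepoll]) (auto simp: variety_interval_def)
next
  define E where "E = {(s, t). satisfies (adjoin_zero S) {(s, t)}}"
  \<comment> \<open>The shift by two skips the grids of size zero and one, whose identities are degenerate.\<close>
  define \<V> :: "nat set \<Rightarrow> 'u sr_alg set" where
    "\<V> P = models (E \<union> (\<lambda>n. grid_identity (n + 2)) ` P)" for P
  have grid_S: "satisfies S {grid_identity (n + 2)}" for n
    using satisfies_if_gen_variety_subset[OF assms(1,2,4)] B21_satisfies_grid_identity[of "n + 2"]
    by (metis le_add2 surj_pair)
  have E_S: "satisfies S {\<sigma>}" "satisfies S7 {\<sigma>}" if "\<sigma> \<in> E" for \<sigma>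
  proof -
    obtain s t where \<sigma>: "\<sigma> = (s, t)" by fastforce
    show "satisfies S {\<sigma>}"
      using that unfolding \<sigma> E_def by (auto intro: satisfies_adjoin_zeroD)
    then show "satisfies S7 {\<sigma>}"
      unfolding \<sigma> by (rule satisfies_if_gen_variety_subset[OF assms(1) ai_semiring_S7 assms(3)])
  qed
  have "\<V> P \<in> variety_interval (gen_variety S) (gen_variety (adjoin_zero S))" for P
  proof -
    have "satisfies S (E \<union> (\<lambda>n. grid_identity (n + 2)) ` P)"
      unfolding satisfies_iff_single[of S "E \<union> _"] using grid_S E_S(1) by blast
    then have "gen_variety S \<subseteq> \<V> P"
      unfolding gen_variety_def \<V>_def by blast
    moreover have "\<V> P \<subseteq> gen_variety (adjoin_zero S)"
      unfolding gen_variety_eq_models E_def[symmetric] by (auto simp: \<V>_def models_def satisfies_def)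
    ultimately show ?thesis
      by (auto simp: variety_interval_def variety_def \<V>_def)
  qed
  moreover have "inj \<V>"
  proof -
    have "n \<in> P" if "\<V> P \<subseteq> \<V> Q" and n: "n \<in> Q" for n P Q
    proof (rule ccontr)
      assume "n \<notin> P"
      let ?A = "grid_algebra (n + 2)"
      have "satisfies ?A {\<sigma>}" if "\<sigma> \<in> E" for \<sigma>
        using grid_algebra_satisfies[OF _ assms(2), of "n + 2"] E_S(2) that
        by (cases \<sigma>) (auto simp: E_def)
      moreover have "satisfies ?A {grid_identity (m + 2)}" if "m \<in> P" for m
        using that \<open>n \<notin> P\<close> by (intro grid_algebra_satisfies_other) auto
      ultimately have sat: "satisfies ?A (E \<union> (\<lambda>n. grid_identity (n + 2)) ` P)"
        unfolding satisfies_iff_single[of ?A "E \<union> _"] by blast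
      have "\<not> satisfies ?A {(fst (grid_identity (n + 2)), snd (grid_identity (n + 2)))}"
        using grid_algebra_fails[of "n + 2"] by simp
      then obtain A :: "'u sr_alg" where A: "ai_semiring A" "\<not> satisfies A {grid_identity (n + 2)}"
        "\<And>\<Sigma>. satisfies ?A \<Sigma> \<Longrightarrow> satisfies A \<Sigma>"
        using failure_in_infinite_universe[OF assms(1)] ai_semiring_syntactic_algebra
        unfolding grid_algebra_def by (metis prod.collapse)
      have "A \<in> \<V> P"
        using A(1) A(3)[OF sat] by (simp add: \<V>_def models_def)
      then have "satisfies A (E \<union> (\<lambda>n. grid_identity (n + 2)) ` Q)"
        using \<open>\<V> P \<subseteq> \<V> Q\<close> by (auto simp: \<V>_def models_def)
      then have "\<forall>\<sigma>\<in>E \<union> (\<lambda>n. grid_identity (n + 2)) ` Q. satisfies A {\<sigma>}"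
        by (subst (asm) satisfies_iff_single)
      moreover have "grid_identity (n + 2) \<in> E \<union> (\<lambda>n. grid_identity (n + 2)) ` Q"
        using n by (intro UnI2 imageI)
      ultimately show False
        using A(2) by (metis (no_types))
    qed
    then show ?thesis
      by (intro injI) blast
  qed
  ultimately show "(UNIV :: nat set set)
      \<lesssim> (variety_interval (gen_variety S) (gen_variety (adjoin_zero S)) :: 'u sr_alg set set)"
    unfolding lepoll_def by blast
qed

end
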